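(* Let $k\ge 1$ and let $d_1,\dots,d_k$ be positive integers. There exist finitely many polynomials $\Delta_0,\dots,\Delta_m\in\mathbb{R}[X_{1\cdots1},\dots,X_{d_1\cdots d_k}]$ (in $d_1\cdots d_k$ variables, regarded as functions on $\mathbb{R}^{d_1\times\dots\times d_k}$) such that the rank $\operatorname{rank}_\otimes(A)$ of any tensor $A\in\mathbb{R}^{d_1\times\dots\times d_k}$ is determined purely by the signs ($+$, $-$ or $0$) of $\Delta_0(A),\dots,\Delta_m(A)$; that is, if $A,A'\in\mathbb{R}^{d_1\times\dots\times d_k}$ satisfy $\operatorname{sign}\Delta_i(A)=\operatorname{sign}\Delta_i(A')$ for all $i=0,\dots,m$, then $\operatorname{rank}_\otimes(A)=\operatorname{rank}_\otimes(A')$.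
   Context: $\mathbb{R}^{d_1\times\dots\times d_k}\cong\mathbb{R}^{d_1}\otimes\dots\otimes\mathbb{R}^{d_k}$ is the space of real $k$-way arrays; $\mathbf{x}_1\otimes\dots\otimes\mathbf{x}_k$ is the array with entries $x^{(1)}_{j_1}\cdots x^{(k)}_{j_k}$ (a decomposable tensor). The outer-product rank $\operatorname{rank}_{\otimes}(A)$ is the least $r\ge 0$ such that $A$ is a sum of $r$ decomposable tensors. For a polynomial $p$ in variables indexed by the array positions, $p(A)$ is $p$ evaluated at the entries of $A$. *)

theory Defs
  imports Complex_Main "HOL-Library.FuncSet" "HOL-Library.Poly_Mapping"
begin

definition tensor_index :: "nat \<Rightarrow> (nat \<Rightarrow> nat) \<Rightarrow> (nat \<Rightarrow> nat) set" where
  "tensor_index k d = (\<Pi>\<^sub>E i\<in>{1..k}. {1..d i})"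

text \<open>
  A real \<open>k\<close>-way array of format \<open>d 1 \<times> \<dots> \<times> d k\<close> is a function on multi-indices that
  vanishes outside \<open>tensor_index k d\<close>; the normalisation makes equality of arrays
  equality of functions, and keeps the carrier closed under pointwise sums.
\<close>

type_synonym tensor = "(nat \<Rightarrow> nat) \<Rightarrow> real"

definition tensors :: "nat \<Rightarrow> (nat \<Rightarrow> nat) \<Rightarrow> tensor set" where
  "tensors k d = {A. \<forall>j. j \<notin> tensor_index k d \<longrightarrow> A j = 0}"

text \<open>
  \<open>x i\<close> stands for the \<open>i\<close>-th vector, with coordinates \<open>x i 1, \<dots>, x i (d i)\<close>; other
  values of \<open>x\<close> are ignored.
\<close>

definition outer_product :: "nat \<Rightarrow> (nat \<Rightarrow> nat) \<Rightarrow> (nat \<Rightarrow> nat \<Rightarrow> real) \<Rightarrow> tensor" where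
  "outer_product k d x = (\<lambda>j. if j \<in> tensor_index k d then \<Prod>i=1..k. x i (j i) else 0)"

definition decomposable :: "nat \<Rightarrow> (nat \<Rightarrow> nat) \<Rightarrow> tensor \<Rightarrow> bool" where
  "decomposable k d T \<longleftrightarrow> (\<exists>x. T = outer_product k d x)"

definition sum_of_decomposables :: "nat \<Rightarrow> (nat \<Rightarrow> nat) \<Rightarrow> tensor \<Rightarrow> nat \<Rightarrow> bool" where
  "sum_of_decomposables k d A r \<longleftrightarrow>
     (\<exists>T :: nat \<Rightarrow> tensor. (\<forall>s<r. decomposable k d (T s)) \<and> A = (\<lambda>j. \<Sum>s<r. T s j))"

definition outer_rank :: "nat \<Rightarrow> (nat \<Rightarrow> nat) \<Rightarrow> tensor \<Rightarrow> nat" where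
  "outer_rank k d A = (LEAST r. sum_of_decomposables k d A r)"

text \<open>
  Polynomials with coefficients in \<open>'a\<close> and variables indexed by \<open>'v\<close>, as finitely supported
  maps from monomials to coefficients, a monomial being a finitely supported map from
  variables to exponents.
\<close>

type_synonym ('v, 'a) mpoly = "('v \<Rightarrow>\<^sub>0 nat) \<Rightarrow>\<^sub>0 'a"

definition mpoly_vars :: "('v, 'a::zero) mpoly \<Rightarrow> 'v set" where
  "mpoly_vars p = (\<Union>m\<in>Poly_Mapping.keys p. Poly_Mapping.keys m)"

definition mpoly_eval :: "('v, 'a::comm_semiring_1) mpoly \<Rightarrow> ('v \<Rightarrow> 'a) \<Rightarrow> 'a" where
  "mpoly_eval p a = (\<Sum>m\<in>Poly_Mapping.keys p. Poly_Mapping.lookup p m * (\<Prod>v\<in>Poly_Mapping.keys m. a v ^ Poly_Mapping.lookup m v))"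

lemma finite_tensor_index: "finite (tensor_index k d)"
  unfolding tensor_index_def by (intro finite_PiE) auto

lemma decomposable_unit:
  assumes "k \<ge> 1" and l: "l \<in> tensor_index k d"
  shows "decomposable k d (\<lambda>j. if j = l then c else 0)"
  unfolding decomposable_def
proof
  define x where "x = (\<lambda>i n. if n = l i then (if i = (1::nat) then c else 1) else 0)"
  have "(if j = l then c else 0) = outer_product k d x j" for j
  proof (cases "j \<in> tensor_index k d")
    case True
    show ?thesis
    proof (cases "j = l")
      case True
      have "(\<Prod>i=1..k. x i (l i)) = (\<Prod>i=1..k. if i = 1 then c else 1)"
        by (simp add: x_def)
      also have "\<dots> = c" using \<open>k \<ge> 1\<close> by (subst prod.delta) auto
      finally show ?thesis using True l by (simp add: outer_product_def)
    next
      case False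
      then obtain i where "i \<in> {1..k}" "j i \<noteq> l i"
        using \<open>j \<in> tensor_index k d\<close> l unfolding tensor_index_def by (metis PiE_ext)
      then have "(\<Prod>i=1..k. x i (j i)) = 0"
        by (intro prod_zero) (auto simp: x_def intro!: bexI[of _ i])
      then show ?thesis using False by (simp add: outer_product_def)
    qed
  next
    case False
    then show ?thesis using l by (auto simp: outer_product_def)
  qed
  then show "(\<lambda>j. if j = l then c else 0) = outer_product k d x" by blast
qed

text \<open>The minimum defining the rank is attained, so \<open>outer_rank\<close> is meaningful on \<open>tensors k d\<close>.\<close>

lemma sum_of_decomposables_outer_rank:
  assumes "k \<ge> 1" and A: "A \<in> tensors k d"
  shows "sum_of_decomposables k d A (outer_rank k d A)"
proof -
  define n where "n = card (tensor_index k d)"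
  obtain l where l: "bij_betw l {..<n} (tensor_index k d)"
    using ex_bij_betw_nat_finite[OF finite_tensor_index, of k d]
    by (auto simp: n_def atLeast0LessThan)
  define T where "T = (\<lambda>s j. if j = l s then A (l s) else 0)"
  have "decomposable k d (T s)" if "s < n" for s
    unfolding T_def using that l \<open>k \<ge> 1\<close> by (intro decomposable_unit) (auto simp: bij_betw_def)
  moreover have "A j = (\<Sum>s<n. T s j)" for j
  proof -
    have "(\<Sum>s<n. T s j) = (\<Sum>i\<in>tensor_index k d. if j = i then A i else 0)"
      unfolding T_def by (rule sum.reindex_bij_betw[OF l])
    also have "\<dots> = A j"
      using A finite_tensor_index by (auto simp: tensors_def sum.delta')
    finally show ?thesis by simp
  qed
  ultimately have "sum_of_decomposables k d A n"
    unfolding sum_of_decomposables_def by (intro exI[of _ T]) auto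
  then show ?thesis unfolding outer_rank_def by (rule LeastI)
qed

end

theory Submission
  imports Defs "HOL-Computational_Algebra.Polynomial"
begin

text \<open>
  Tensors of rank at most \<open>r\<close> form the projection of a real algebraic set, so the theorem is an
  instance of the Tarski--Seidenberg principle. Quantifier elimination is done semantically,
  following Cohen and Hoermander: a finite family of univariate polynomials with parameters has
  the same sign diagram at two parameter values if a finite order isomorphism between the roots
  transports all signs. A polynomial \<open>p\<close> of top degree is added to a family \<open>Q\<close> containing
  \<open>p'\<close> using that \<open>p\<close> is monotone between consecutive roots of \<open>Q\<close>, and that its sign at a root
  of \<open>q \<in> Q\<close> is, up to a power of the leading coefficient of \<open>q\<close>, the sign of a pseudo-remainder
  of lower degree. Thus the signs of finitely many polynomials in the parameters determine
  the diagram.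
\<close>

section \<open>Sign diagrams of univariate polynomials\<close>

text \<open>The polynomial equations behind the projection involve many unknowns, so unknowns are
  eliminated one at a time, with all remaining variables as parameters. Only the existence of a
  finite family of parameter functions is tracked, never a formula. The obstacle is that degrees
  jump with the parameter, since a leading coefficient may vanish. Hence the signs of all
  coefficients are recorded, a truncation stands in for a polynomial that loses its top coefficient,
  and a pseudo-remainder is prepared for every possible degree of the divisor. A second obstacle:
  the sign of \<open>p\<close> is controlled only at roots of nonzero members of \<open>Q\<close>,
  whereas the diagram supplied by induction may have further knots, such as roots of the
  pseudo-remainders; they are discarded before \<open>p\<close> is added. Cells are never
  enumerated: two points correspond if they compare alike with all corresponding knots. Finally, the
  rank never exceeds the number of entries, so finitely many \<open>r\<close> suffice.\<close>

text \<open>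
  The pairs in \<open>C\<close> are corresponding knots, \<open>matches C t s\<close> says that \<open>t\<close> and \<open>s\<close> lie in
  corresponding cells (knots or open intervals between them).
\<close>

definition matches :: "(real \<times> real) set \<Rightarrow> real \<Rightarrow> real \<Rightarrow> bool" where
  "matches C t s \<longleftrightarrow> (\<forall>a b. (a, b) \<in> C \<longrightarrow> sgn (t - a) = sgn (s - b))"

text \<open>Matching the knots against each other makes \<open>C\<close> the graph of a strictly
  increasing bijection between finite sets: a difference of sign 0 on one side forces sign 0 on the
  other.\<close>

definition order_iso :: "(real \<times> real) set \<Rightarrow> bool" where
  "order_iso C \<longleftrightarrow> finite C \<and> (\<forall>a b. (a, b) \<in> C \<longrightarrow> matches C a b)"

lemma matchesD: "matches C t s \<Longrightarrow> (a, b) \<in> C \<Longrightarrow> sgn (t - a) = sgn (s - b)"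
  by (simp add: matches_def)

lemma order_iso_matches: "order_iso C \<Longrightarrow> (a, b) \<in> C \<Longrightarrow> matches C a b"
  by (simp add: order_iso_def)

lemma order_iso_subset: "order_iso C \<Longrightarrow> D \<subseteq> C \<Longrightarrow> order_iso D"
  unfolding order_iso_def matches_def by (meson finite_subset subsetD)

lemma matches_converse: "matches (C\<inverse>) s t \<longleftrightarrow> matches C t s"
  unfolding matches_def by (metis converse_iff)

lemma order_iso_converse: "order_iso C \<Longrightarrow> order_iso (C\<inverse>)"
  by (simp add: order_iso_def matches_converse)

lemma sgn_diff_less_iff: "sgn (t - a) = sgn (s - b) \<Longrightarrow> (t < a \<longleftrightarrow> s < b) \<and> (a < t \<longleftrightarrow> b < s) \<and> (t = a \<longleftrightarrow> s = b)"
  for a b s t :: real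
  by (auto simp: sgn_if split: if_splits)

lemma sgn_diff_eqI: "(t < a \<longleftrightarrow> s < b) \<Longrightarrow> (t = a \<longleftrightarrow> s = b) \<Longrightarrow> sgn (t - a) = sgn (s - b)"
  for a b s t :: real
  by (auto simp: sgn_if split: if_splits)

lemma matches_less_iff:
  assumes "matches C t s" "(a, b) \<in> C"
  shows "t < a \<longleftrightarrow> s < b" "a < t \<longleftrightarrow> b < s" "t = a \<longleftrightarrow> s = b"
  using sgn_diff_less_iff[OF matchesD[OF assms]] by auto

lemma matches_convex:
  assumes "matches C t s" "matches C t' s" "t \<le> x" "x \<le> t'"
  shows "matches C x s"
  unfolding matches_def
proof (intro allI impI)
  fix a b assume "(a, b) \<in> C"
  then show "sgn (x - a) = sgn (s - b)"
    using matches_less_iff[OF assms(1)] matches_less_iff[OF assms(2)] assms(3,4)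
    by (intro sgn_diff_eqI) (smt (verit))+
qed

lemma matches_convex_right:
  "matches C t s \<Longrightarrow> matches C t s' \<Longrightarrow> s \<le> x \<Longrightarrow> x \<le> s' \<Longrightarrow> matches C t x"
  using matches_convex[of "C\<inverse>" s t s' x] by (simp add: matches_converse)

text \<open>Density of the reals, and the absence of endpoints when \<open>L\<close> or
  \<open>U\<close> is empty; the latter case serves the unbounded cells.\<close>

lemma finite_separation:
  fixes L U :: "real set"
  assumes "finite L" "finite U" "\<And>l u. l \<in> L \<Longrightarrow> u \<in> U \<Longrightarrow> l < u"
  shows "\<exists>s. (\<forall>l\<in>L. l < s) \<and> (\<forall>u\<in>U. s < u)"
proof (cases "L = {} \<or> U = {}")
  case True
  have "\<forall>l\<in>L. l < Max L + 1" "\<forall>u\<in>U. Min U - 1 < u"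
    using Max_ge[OF assms(1)] Min_le[OF assms(2)] by force+
  with True show ?thesis by blast
next
  case False
  then have "Max L < Min U" using assms by auto
  then obtain s where "Max L < s" "s < Min U" using dense by blast
  then show ?thesis using assms(1,2) False by (intro exI[of _ s]) auto
qed

text \<open>The extension step of a back-and-forth argument: the partners of the knots below
  \<open>t\<close> lie below those of the knots above \<open>t\<close>, so some real separates
  them.\<close>

lemma order_iso_total:
  assumes C: "order_iso C"
  shows "\<exists>s. matches C t s"
proof (cases "t \<in> fst ` C")
  case True
  then show ?thesis using order_iso_matches[OF C] by force
next
  case False
  have fin: "finite C" using C by (simp add: order_iso_def)
  define L where "L = snd ` {c \<in> C. fst c < t}"
  define U where "U = snd ` {c \<in> C. t < fst c}"
  have "\<exists>s. (\<forall>l\<in>L. l < s) \<and> (\<forall>u\<in>U. s < u)"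
  proof (rule finite_separation)
    fix l u assume "l \<in> L" "u \<in> U"
    then obtain a b where "(a, l) \<in> C" "a < t" "(b, u) \<in> C" "t < b"
      by (auto simp: L_def U_def)
    then show "l < u"
      using matches_less_iff(1)[OF order_iso_matches[OF C], of a l b u] by auto
  qed (use fin in \<open>auto simp: L_def U_def\<close>)
  then obtain s where s: "\<And>l. l \<in> L \<Longrightarrow> l < s" "\<And>u. u \<in> U \<Longrightarrow> s < u" by blast
  have "matches C t s"
    unfolding matches_def
  proof (intro allI impI)
    fix a b assume ab: "(a, b) \<in> C"
    then have "a \<noteq> t" using False by force
    then consider "a < t" | "t < a" by linarith
    then show "sgn (t - a) = sgn (s - b)"
    proof cases
      case 1
      then have "b \<in> L" using ab by (force simp: L_def)
      then show ?thesis using 1 s by simp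
    next
      case 2
      then have "b \<in> U" using ab by (force simp: U_def)
      then show ?thesis using 2 s by simp
    qed
  qed
  then show ?thesis ..
qed

lemma order_iso_surj:
  assumes "order_iso C"
  shows "\<exists>t. matches C t s"
  using order_iso_total[OF order_iso_converse[OF assms], of s] by (simp add: matches_converse)

text \<open>The root clauses exclude the zero polynomial because \<open>C\<close> is finite. Knots
  that are not roots are allowed, which makes the notion pass to subfamilies.\<close>

definition sign_iso :: "(real \<times> real) set \<Rightarrow> (real poly \<times> real poly) set \<Rightarrow> bool" where
  "sign_iso C P \<longleftrightarrow> order_iso C \<and>
     (\<forall>u v. (u, v) \<in> P \<longrightarrow>
        (\<forall>t. u \<noteq> 0 \<longrightarrow> poly u t = 0 \<longrightarrow> t \<in> fst ` C) \<and>
        (\<forall>s. v \<noteq> 0 \<longrightarrow> poly v s = 0 \<longrightarrow> s \<in> snd ` C) \<and>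
        (\<forall>t s. matches C t s \<longrightarrow> sgn (poly u t) = sgn (poly v s)))"

lemma sign_isoD:
  assumes "sign_iso C P"
  shows "order_iso C"
    and "(u, v) \<in> P \<Longrightarrow> u \<noteq> 0 \<Longrightarrow> poly u t = 0 \<Longrightarrow> t \<in> fst ` C"
    and "(u, v) \<in> P \<Longrightarrow> v \<noteq> 0 \<Longrightarrow> poly v s = 0 \<Longrightarrow> s \<in> snd ` C"
    and "(u, v) \<in> P \<Longrightarrow> matches C t s \<Longrightarrow> sgn (poly u t) = sgn (poly v s)"
  using assms unfolding sign_iso_def by blast+

lemma sign_iso_subset: "sign_iso C P \<Longrightarrow> Q \<subseteq> P \<Longrightarrow> sign_iso C Q"
  unfolding sign_iso_def by blast

lemma sgn_poly_eq_if_no_root: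
  fixes p :: "real poly"
  assumes "\<And>x. min s t \<le> x \<Longrightarrow> x \<le> max s t \<Longrightarrow> poly p x \<noteq> 0"
  shows "sgn (poly p s) = sgn (poly p t)"
proof (rule ccontr)
  assume neq: "sgn (poly p s) \<noteq> sgn (poly p t)"
  have "poly p s \<noteq> 0" "poly p t \<noteq> 0" using assms by auto
  with neq have "poly p s * poly p t < 0"
    by (auto simp: sgn_if mult_less_0_iff split: if_splits)
  have "s \<noteq> t" using neq by auto
  then have "\<exists>x. min s t \<le> x \<and> x \<le> max s t \<and> poly p x = 0"
  proof (cases "s < t")
    case True
    then show ?thesis using poly_IVT[of s t p] \<open>poly p s * poly p t < 0\<close>
      by (auto simp: min_def max_def intro: less_imp_le)
  next
    case False
    then have "t < s" using \<open>s \<noteq> t\<close> by simp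
    then show ?thesis using poly_IVT[of t s p] \<open>poly p s * poly p t < 0\<close>
      by (auto simp: min_def max_def mult.commute intro: less_imp_le)
  qed
  then show False using assms by blast
qed

text \<open>Every real has a matching partner on the other side, so identical vanishing is
  transported pointwise.\<close>

lemma sign_iso_zero_iff:
  assumes "sign_iso C P" "(u, v) \<in> P"
  shows "u = 0 \<longleftrightarrow> v = 0"
proof
  assume "u = 0"
  then have "poly v s = 0" for s
    using order_iso_surj[OF sign_isoD(1)[OF assms(1)], of s] sign_isoD(4)[OF assms]
    by (metis poly_0 sgn_0 sgn_0_0)
  then show "v = 0" using poly_all_0_iff_0 by blast
next
  assume "v = 0"
  then have "poly u s = 0" for s
    using order_iso_total[OF sign_isoD(1)[OF assms(1)], of s] sign_isoD(4)[OF assms]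
    by (metis poly_0 sgn_0 sgn_0_0)
  then show "u = 0" using poly_all_0_iff_0 by blast
qed

text \<open>Removing knots merges cells, but inside a merged cell no nonzero member has a root, so
  no sign changes there. Afterwards every knot is a root of a member, and this is where a
  pseudo-remainder can reveal the sign of a new polynomial.\<close>

lemma sign_iso_restrict:
  assumes iso: "sign_iso C P"
  defines "D \<equiv> {(a, b) \<in> C. \<exists>u v. (u, v) \<in> P \<and> u \<noteq> 0 \<and> poly u a = 0}"
  shows "sign_iso D P"
proof -
  have sub: "D \<subseteq> C" by (auto simp: D_def)
  have D: "order_iso D" using sign_isoD(1)[OF iso] sub by (rule order_iso_subset)
  have fst: "t \<in> fst ` D" if "(u, v) \<in> P" "u \<noteq> 0" "poly u t = 0" for u v t
    using sign_isoD(2)[OF iso that] that unfolding D_def by force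
  have snd: "s \<in> snd ` D" if uv: "(u, v) \<in> P" "v \<noteq> 0" "poly v s = 0" for u v s
  proof -
    obtain a where a: "(a, s) \<in> C" using sign_isoD(3)[OF iso uv] by force
    have "sgn (poly u a) = sgn (poly v s)"
      using sign_isoD(4)[OF iso uv(1) order_iso_matches[OF sign_isoD(1)[OF iso] a]] .
    then have "poly u a = 0" using uv(3) by (simp add: sgn_zero_iff)
    moreover have "u \<noteq> 0" using sign_iso_zero_iff[OF iso uv(1)] uv(2) by simp
    ultimately have "(a, s) \<in> D" using a uv(1) unfolding D_def by blast
    then show ?thesis by force
  qed
  have "sgn (poly u t) = sgn (poly v s)" if uv: "(u, v) \<in> P" and ts: "matches D t s" for u v t s
  proof (cases "v = 0 \<or> s \<in> snd ` D")
    case True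
    then show ?thesis
    proof
      assume "v = 0"
      then show ?thesis using sign_iso_zero_iff[OF iso uv] by simp
    next
      assume "s \<in> snd ` D"
      then obtain a where a: "(a, s) \<in> D" by force
      then have "t = a" using matches_less_iff(3)[OF ts a] by simp
      then show ?thesis
        using a sub sign_isoD(4)[OF iso uv] order_iso_matches[OF sign_isoD(1)[OF iso]] by blast
    qed
  next
    case False
    \<comment> \<open>\<open>s'\<close> matches \<open>t\<close> in the finer diagram, where signs
      are known to agree; \<open>s\<close> and \<open>s'\<close> share a cell of \<open>D\<close>,
      on which \<open>v\<close> has no root.\<close>
    obtain s' where s': "matches C t s'" using order_iso_total[OF sign_isoD(1)[OF iso]] by blast
    then have ts': "matches D t s'" using sub unfolding matches_def by blast
    have "sgn (poly v s') = sgn (poly v s)"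
    proof (rule sgn_poly_eq_if_no_root, rule notI)
      fix x assume x: "min s' s \<le> x" "x \<le> max s' s" "poly v x = 0"
      have tx: "matches D t x"
        using matches_convex_right[OF ts ts', of x] matches_convex_right[OF ts' ts, of x] x
        by (cases "s \<le> s'") auto
      obtain a where a: "(a, x) \<in> D" using snd[OF uv _ x(3)] False by force
      have "t = a" using matches_less_iff(3)[OF tx a] by simp
      then have "s = x" using matches_less_iff(3)[OF ts a] by simp
      then show False using a False by force
    qed
    then show ?thesis using sign_isoD(4)[OF iso uv s'] by simp
  qed
  then show ?thesis unfolding sign_iso_def using D fst snd by blast
qed

section \<open>Transfer of signs along a cell of monotonicity\<close>

text \<open>The leading coefficient of the derivative is that of \<open>p\<close> times the degree,
  so it must be positive, and \<open>p\<close> eventually exceeds any bound below it. Here it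
  matters that \<open>p\<close> is a polynomial: -exp(-x) increases without ever becoming
  positive.\<close>

lemma poly_pos_if_pderiv_pos_at_top:
  fixes p :: "real poly"
  assumes "\<And>x. x > c \<Longrightarrow> poly (pderiv p) x > 0"
  shows "\<exists>x>c. poly p x > 0"
proof -
  have deg: "degree p \<noteq> 0"
    using assms[of "c + 1"] pderiv_eq_0_iff[of p] by auto
  have lc: "lead_coeff (pderiv p) = of_nat (degree p) * lead_coeff p"
    using deg by (simp add: degree_pderiv coeff_pderiv)
  have "lead_coeff p > 0"
  proof (rule ccontr)
    assume "\<not> lead_coeff p > 0"
    moreover have "lead_coeff p \<noteq> 0" using deg by auto
    ultimately have "lead_coeff p < 0" by linarith
    then have "lead_coeff (- pderiv p) > 0"
      using lc deg by (simp add: mult_pos_neg)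
    from poly_pinfty_gt_lc[OF this] obtain n where
      "\<And>x. x \<ge> n \<Longrightarrow> poly (- pderiv p) x \<ge> lead_coeff (- pderiv p)" by blast
    from this[of "max n (c + 1)"] assms[of "max n (c + 1)"] \<open>lead_coeff (- pderiv p) > 0\<close>
    show False by (simp add: less_max_iff_disj)
  qed
  from poly_pinfty_gt_lc[OF this] obtain n where
    "\<And>x. x \<ge> n \<Longrightarrow> poly p x \<ge> lead_coeff p" by blast
  from this[of "max n (c + 1)"] \<open>lead_coeff p > 0\<close> show ?thesis
    by (intro exI[of _ "max n (c + 1)"]) (auto simp: less_max_iff_disj)
qed

text \<open>
  On a cell where \<open>p\<close> increases, positivity of \<open>p\<close> somewhere is visible at the right endpoint,
  or is automatic if there is none.
\<close>

lemma pos_transfer_increasing: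
  fixes p q :: "real poly"
  assumes C: "order_iso C" and ts: "matches C t s" and tC: "t \<notin> fst ` C"
    and dp: "\<And>x. matches C x s \<Longrightarrow> poly (pderiv p) x > 0"
    and dq: "\<And>y. matches C t y \<Longrightarrow> poly (pderiv q) y > 0"
    and ends: "\<And>a b. (a, b) \<in> C \<Longrightarrow> sgn (poly p a) = sgn (poly q b)"
    and t1: "matches C t1 s" "poly p t1 > 0"
  shows "\<exists>s1. matches C t s1 \<and> poly q s1 > 0"
proof (cases "\<exists>a b. (a, b) \<in> C \<and> t < a")
  case False
  \<comment> \<open>Without a knot above \<open>t\<close> the right-hand cell contains every
    \<open>x > s\<close>, so the behaviour of \<open>q\<close> at infinity decides.\<close>
  have ge: "matches C t x" if "x > s" for x
    unfolding matches_def
  proof (intro allI impI)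
    fix a b assume ab: "(a, b) \<in> C"
    then have "a \<noteq> t" using tC by force
    with False ab have "a < t" by force
    then show "sgn (t - a) = sgn (x - b)"
      using matches_less_iff(2)[OF ts ab] that by simp
  qed
  then obtain x where "x > s" "poly q x > 0"
    using poly_pos_if_pderiv_pos_at_top[of s q] dq by blast
  then show ?thesis using ge by blast
next
  case True
  define A where "A = {a \<in> fst ` C. t < a}"
  have "finite A" using C by (simp add: A_def order_iso_def)
  moreover have "A \<noteq> {}" using True by (force simp: A_def)
  ultimately have "Min A \<in> A" and Min: "\<And>a. a \<in> A \<Longrightarrow> Min A \<le> a" by auto
  then obtain b where b: "(Min A, b) \<in> C" "t < Min A" by (force simp: A_def)
  define a where "a = Min A"
  note b = b[folded a_def]
  have sb: "s < b" using matches_less_iff(1)[OF ts b(1)] b(2) by simp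
  have below: "matches C t y" if "s < y" "y < b" for y
    unfolding matches_def
  proof (intro allI impI)
    fix c d assume cd: "(c, d) \<in> C"
    then have "c \<noteq> t" using tC by force
    then consider "c < t" | "t < c" by linarith
    then show "sgn (t - c) = sgn (y - d)"
    proof cases
      case 1
      then show ?thesis using matches_less_iff(2)[OF ts cd] that by simp
    next
      case 2
      then have "a \<le> c" using Min cd by (force simp: A_def a_def)
      then have "b \<le> d"
        using matches_less_iff[OF order_iso_matches[OF C b(1)] cd] by linarith
      then show ?thesis using 2 that by simp
    qed
  qed
  have below': "matches C x s" if "t1 \<le> x" "x < a" for x
    unfolding matches_def
  proof (intro allI impI)
    fix c d assume cd: "(c, d) \<in> C"
    then have "c \<noteq> t" using tC by force
    then consider "c < t" | "t < c" by linarith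
    then show "sgn (x - c) = sgn (s - d)"
    proof cases
      case 1
      then show ?thesis
        using matches_less_iff(2)[OF ts cd] matches_less_iff(2)[OF t1(1) cd] that by simp
    next
      case 2
      then have "a \<le> c" using Min cd by (force simp: A_def a_def)
      then show ?thesis using 2 that matches_less_iff(1)[OF ts cd] by simp
    qed
  qed
  have "t1 < a" using matches_less_iff(1)[OF t1(1) b(1)] sb by simp
  then obtain x where "t1 < x" "x < a" "poly p a - poly p t1 = (a - t1) * poly (pderiv p) x"
    using poly_MVT by blast
  moreover have "poly (pderiv p) x > 0" using below' dp calculation by simp
  ultimately have "poly p a - poly p t1 > 0" using \<open>t1 < a\<close> by simp
  then have "poly p a > 0" using t1(2) by linarith
  then have "poly q b > 0" using ends[OF b(1)] by (simp add: sgn_if split: if_splits)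
  \<comment> \<open>The knot \<open>b\<close> itself lies outside the open cell; continuity moves
    the positivity of \<open>q\<close> to points just left of it.\<close>
  have "(poly q \<longlongrightarrow> poly q b) (at_left b)"
    by (rule tendsto_within_subset[OF isContD[OF poly_isCont]]) auto
  then have "eventually (\<lambda>y. poly q y > 0) (at_left b)"
    using \<open>poly q b > 0\<close> by (rule order_tendstoD(1))
  moreover have "eventually (\<lambda>y. y \<in> {s<..<b}) (at_left b)"
    using eventually_at_left_real[OF sb] .
  ultimately have "\<exists>y. poly q y > 0 \<and> y \<in> {s<..<b}"
    using eventually_happens'[OF _ eventually_conj] trivial_limit_at_left_real by blast
  then show ?thesis using below by auto
qed

text \<open>Reflecting both lines in the origin turns decreasing polynomials into increasing ones,
  so that only right endpoints have to be analysed.\<close>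

definition mirror :: "(real \<times> real) set \<Rightarrow> (real \<times> real) set" where
  "mirror C = (\<lambda>(a, b). (- a, - b)) ` C"

lemma mem_mirror: "(a, b) \<in> mirror C \<longleftrightarrow> (- a, - b) \<in> C"
  by (force simp: mirror_def)

lemma matches_mirror: "matches (mirror C) t s \<longleftrightarrow> matches C (- t) (- s)"
proof -
  have *: "sgn (t - - a) = sgn (s - - b) \<longleftrightarrow> sgn (- t - a) = sgn (- s - b)" for a b
    by (auto simp: sgn_if)
  have "matches (mirror C) t s \<longleftrightarrow> (\<forall>a b. (a, b) \<in> C \<longrightarrow> sgn (t - - a) = sgn (s - - b))"
    unfolding matches_def mem_mirror by (metis minus_minus)
  then show ?thesis unfolding * matches_def .
qed

lemma order_iso_mirror: "order_iso C \<Longrightarrow> order_iso (mirror C)"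
  unfolding order_iso_def matches_mirror by (auto simp: mem_mirror) (simp add: mirror_def)

text \<open>A negative \<open>\<sigma>\<close> is reduced to the increasing case by substituting
  \<open>-x\<close>, which keeps the values and flips the sign of the derivative.\<close>

lemma pos_transfer:
  fixes p q :: "real poly"
  assumes C: "order_iso C" and ts: "matches C t s" and tC: "t \<notin> fst ` C"
    and \<sigma>: "\<sigma> \<noteq> 0"
    and dp: "\<And>x. matches C x s \<Longrightarrow> sgn (poly (pderiv p) x) = \<sigma>"
    and dq: "\<And>y. matches C t y \<Longrightarrow> sgn (poly (pderiv q) y) = \<sigma>"
    and ends: "\<And>a b. (a, b) \<in> C \<Longrightarrow> sgn (poly p a) = sgn (poly q b)"
    and t1: "matches C t1 s" "poly p t1 > 0"
  shows "\<exists>s1. matches C t s1 \<and> poly q s1 > 0"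
proof (cases "\<sigma> > 0")
  case True
  have "poly (pderiv p) x > 0" if "matches C x s" for x
    using dp[OF that] True by (metis sgn_greater)
  moreover have "poly (pderiv q) y > 0" if "matches C t y" for y
    using dq[OF that] True by (metis sgn_greater)
  ultimately show ?thesis using pos_transfer_increasing[OF C ts tC _ _ ends t1] by blast
next
  case False
  let ?r = "\<lambda>p. pcompose p [:0, -1 :: real:]"
  have dr: "poly (pderiv (?r p)) x = - poly (pderiv p) (- x)" for p x
    by (simp add: pderiv_pcompose poly_pcompose pderiv_pCons)
  have dp': "poly (pderiv p) x < 0" if "matches C x s" for x
    using dp[OF that] False \<sigma> by (metis sgn_less linorder_neqE_linordered_idom)
  have dq': "poly (pderiv q) y < 0" if "matches C t y" for y
    using dq[OF that] False \<sigma> by (metis sgn_less linorder_neqE_linordered_idom)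
  have "\<exists>s1. matches (mirror C) (- t) s1 \<and> poly (?r q) s1 > 0"
  proof (rule pos_transfer_increasing[where ?t1.0 = "- t1" and p = "?r p" and s = "- s"])
    show "- t \<notin> fst ` mirror C" using tC by (force simp: mirror_def)
    show "poly (pderiv (?r p)) x > 0" if "matches (mirror C) x (- s)" for x
      using dp'[of "- x"] that by (simp add: matches_mirror dr)
    show "poly (pderiv (?r q)) x > 0" if "matches (mirror C) (- t) x" for x
      using dq'[of "- x"] that by (simp add: matches_mirror dr)
    show "sgn (poly (?r p) a) = sgn (poly (?r q) b)" if "(a, b) \<in> mirror C" for a b
      using ends[of "- a" "- b"] that by (simp add: poly_pcompose mem_mirror)
  qed (use t1 C ts in \<open>simp_all add: order_iso_mirror matches_mirror poly_pcompose\<close>)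
  then show ?thesis by (auto simp: matches_mirror poly_pcompose)
qed

lemma neg_transfer:
  fixes p q :: "real poly"
  assumes C: "order_iso C" and ts: "matches C t s" and tC: "t \<notin> fst ` C"
    and \<sigma>: "\<sigma> \<noteq> 0"
    and dp: "\<And>x. matches C x s \<Longrightarrow> sgn (poly (pderiv p) x) = \<sigma>"
    and dq: "\<And>y. matches C t y \<Longrightarrow> sgn (poly (pderiv q) y) = \<sigma>"
    and ends: "\<And>a b. (a, b) \<in> C \<Longrightarrow> sgn (poly p a) = sgn (poly q b)"
    and t1: "matches C t1 s" "poly p t1 < 0"
  shows "\<exists>s1. matches C t s1 \<and> poly q s1 < 0"
proof -
  have "\<exists>s1. matches C t s1 \<and> poly (- q) s1 > 0"
  proof (rule pos_transfer[OF C ts tC, where \<sigma> = "- \<sigma>" and p = "- p"])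
    show "sgn (poly (- p) a) = sgn (poly (- q) b)" if "(a, b) \<in> C" for a b
      using ends[OF that] by (simp add: sgn_minus)
  qed (use \<sigma> dp dq t1 in \<open>simp_all add: pderiv_minus sgn_minus\<close>)
  then show ?thesis by simp
qed

section \<open>Extending a sign diagram by one polynomial\<close>

lemma matches_trans: "matches C t s \<Longrightarrow> matches C t' s \<Longrightarrow> matches C t' s' \<Longrightarrow> matches C t s'"
  unfolding matches_def by metis

lemma matches_between:
  "matches C a s \<Longrightarrow> matches C b s \<Longrightarrow> min a b \<le> x \<Longrightarrow> x \<le> max a b \<Longrightarrow> matches C x s"
  using matches_convex[of C a s b x] matches_convex[of C b s a x] by (cases "a \<le> b") simp_all

lemma matches_between_right:
  "matches C t a \<Longrightarrow> matches C t b \<Longrightarrow> min a b \<le> x \<Longrightarrow> x \<le> max a b \<Longrightarrow> matches C t x"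
  using matches_between[of "C\<inverse>" a t b x] by (simp add: matches_converse)

lemma sgn_poly_diff:
  fixes p :: "real poly"
  assumes "\<And>x. min a b \<le> x \<Longrightarrow> x \<le> max a b \<Longrightarrow> sgn (poly (pderiv p) x) = \<sigma>"
  shows "sgn (poly p b - poly p a) = sgn (b - a) * \<sigma>"
proof -
  obtain x where "x \<in> {min a b..max a b}" "poly p b - poly p a = (b - a) * poly (pderiv p) x"
    using poly_MVT'[of a b "{min a b..max a b}" p] by blast
  then show ?thesis using assms[of x] by (simp add: sgn_mult)
qed

lemma poly_root_between:
  fixes p :: "real poly"
  assumes "poly p a < 0" "poly p b > 0"
  shows "\<exists>x. min a b \<le> x \<and> x \<le> max a b \<and> poly p x = 0"
proof (rule ccontr)
  assume "\<not> ?thesis"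
  then have "sgn (poly p a) = sgn (poly p b)" by (intro sgn_poly_eq_if_no_root) blast
  then show False using assms by simp
qed

text \<open>Finitely many knots keep a distance from a point that is not a knot. This provides
  points of the same cell on both sides of a root.\<close>

lemma matches_open:
  assumes C: "order_iso C" and ts: "matches C t s" and tC: "t \<notin> fst ` C"
  shows "\<exists>l u. l < t \<and> t < u \<and> (\<forall>x. l < x \<longrightarrow> x < u \<longrightarrow> matches C x s)"
proof -
  have fin: "finite C" using C by (simp add: order_iso_def)
  have "\<exists>l. (\<forall>a\<in>{a \<in> fst ` C. a < t}. a < l) \<and> (\<forall>u\<in>{t}. l < u)"
    by (rule finite_separation) (use fin in auto)
  then obtain l where l: "\<And>a. a \<in> fst ` C \<Longrightarrow> a < t \<Longrightarrow> a < l" "l < t" by blast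
  have "\<exists>u. (\<forall>a\<in>{t}. a < u) \<and> (\<forall>a\<in>{a \<in> fst ` C. t < a}. u < a)"
    by (rule finite_separation) (use fin in auto)
  then obtain u where u: "\<And>a. a \<in> fst ` C \<Longrightarrow> t < a \<Longrightarrow> u < a" "t < u" by blast
  have "matches C x s" if x: "l < x" "x < u" for x
    unfolding matches_def
  proof (intro allI impI)
    fix a b assume ab: "(a, b) \<in> C"
    then have "a \<in> fst ` C" by force
    then have "sgn (x - a) = sgn (t - a)"
      using l(1)[of a] u(1)[of a] tC x by (cases a t rule: linorder_cases) auto
    then show "sgn (x - a) = sgn (s - b)" using matchesD[OF ts ab] by simp
  qed
  then show ?thesis using l(2) u(2) by blast
qed

lemma sign_iso_converse:
  assumes iso: "sign_iso C P"
  shows "sign_iso (C\<inverse>) (P\<inverse>)"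
  unfolding sign_iso_def
proof (intro conjI allI impI)
  show "order_iso (C\<inverse>)" using sign_isoD(1)[OF iso] by (rule order_iso_converse)
  fix v u assume "(v, u) \<in> P\<inverse>"
  then have uv: "(u, v) \<in> P" by simp
  show "s \<in> fst ` (C\<inverse>)" if "v \<noteq> 0" "poly v s = 0" for s
    using sign_isoD(3)[OF iso uv that] by force
  show "t \<in> snd ` (C\<inverse>)" if "u \<noteq> 0" "poly u t = 0" for t
    using sign_isoD(2)[OF iso uv that] by force
  show "sgn (poly v s) = sgn (poly u t)" if "matches (C\<inverse>) s t" for s t
    using sign_isoD(4)[OF iso uv] that by (simp add: matches_converse)
qed

text \<open>\<open>p\<close> and \<open>q\<close> stand for the new member at two parameter values.
  Besides the derivative, the only information about them is \<open>sgn_knots\<close>, which the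
  pseudo-remainders will supply.\<close>

locale sign_iso_step =
  fixes C :: "(real \<times> real) set" and P :: "(real poly \<times> real poly) set" and p q :: "real poly"
  assumes iso: "sign_iso C P"
    and pderiv_mem: "(pderiv p, pderiv q) \<in> P"
    and pderiv_nz: "pderiv p \<noteq> 0" "pderiv q \<noteq> 0"
    and sgn_knots: "(a, b) \<in> C \<Longrightarrow> sgn (poly p a) = sgn (poly q b)"
begin

lemma C: "order_iso C"
  using iso by (rule sign_isoD)

lemma converse_step: "sign_iso_step (C\<inverse>) (P\<inverse>) q p"
  using sign_iso_converse[OF iso] pderiv_mem pderiv_nz sgn_knots by unfold_locales auto

lemma matches_knot: "matches C t s \<Longrightarrow> t \<in> fst ` C \<Longrightarrow> (t, s) \<in> C"
  by (auto dest: matches_less_iff(3))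

lemma matches_knot': "matches C t s \<Longrightarrow> s \<in> snd ` C \<Longrightarrow> (t, s) \<in> C"
  by (auto dest: matches_less_iff(3))

text \<open>Roots of the derivative are knots, so in an open cell the derivative is nonzero, and the
  diagram gives it one common sign on both sides.\<close>

lemma sgn_pderiv:
  assumes "matches C t s" "t \<notin> fst ` C"
  shows "sgn (poly (pderiv p) t) \<noteq> 0"
    and "matches C x s \<Longrightarrow> sgn (poly (pderiv p) x) = sgn (poly (pderiv p) t)"
    and "matches C t y \<Longrightarrow> sgn (poly (pderiv q) y) = sgn (poly (pderiv p) t)"
proof -
  show "sgn (poly (pderiv p) t) \<noteq> 0"
    using assms(2) sign_isoD(2)[OF iso pderiv_mem pderiv_nz(1)] by (auto simp: sgn_zero_iff)
  show "sgn (poly (pderiv p) x) = sgn (poly (pderiv p) t)" if "matches C x s"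
    using sign_isoD(4)[OF iso pderiv_mem that] sign_isoD(4)[OF iso pderiv_mem assms(1)] by metis
  show "sgn (poly (pderiv q) y) = sgn (poly (pderiv p) t)" if "matches C t y"
    using sign_isoD(4)[OF iso pderiv_mem that] by metis
qed

lemma sgn_left_diff:
  assumes "matches C t s" "t \<notin> fst ` C" "matches C a s" "matches C b s"
  shows "sgn (poly p b - poly p a) = sgn (b - a) * sgn (poly (pderiv p) t)"
proof (rule sgn_poly_diff)
  fix x assume "min a b \<le> x" "x \<le> max a b"
  then have "matches C x s" by (rule matches_between[OF assms(3,4)])
  then show "sgn (poly (pderiv p) x) = sgn (poly (pderiv p) t)"
    using sgn_pderiv(2) assms by blast
qed

lemma sgn_right_diff:
  assumes "matches C t s" "t \<notin> fst ` C" "matches C t a" "matches C t b"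
  shows "sgn (poly q b - poly q a) = sgn (b - a) * sgn (poly (pderiv p) t)"
proof (rule sgn_poly_diff)
  fix x assume "min a b \<le> x" "x \<le> max a b"
  then have "matches C t x" by (rule matches_between_right[OF assms(3,4)])
  then show "sgn (poly (pderiv q) x) = sgn (poly (pderiv p) t)"
    using sgn_pderiv(3) assms by blast
qed

lemma pos_right:
  assumes "matches C t s" "t \<notin> fst ` C" "matches C x s" "poly p x > 0"
  shows "\<exists>y. matches C t y \<and> poly q y > 0"
proof (rule pos_transfer[OF C assms(1,2)])
  show "sgn (poly (pderiv p) t) \<noteq> 0" by (rule sgn_pderiv(1)[OF assms(1,2)])
  show "sgn (poly (pderiv p) x) = sgn (poly (pderiv p) t)" if "matches C x s" for x
    by (rule sgn_pderiv(2)[OF assms(1,2) that])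
  show "sgn (poly (pderiv q) y) = sgn (poly (pderiv p) t)" if "matches C t y" for y
    by (rule sgn_pderiv(3)[OF assms(1,2) that])
  show "sgn (poly p a) = sgn (poly q b)" if "(a, b) \<in> C" for a b
    using that by (rule sgn_knots)
qed (rule assms)+


lemma neg_right:
  assumes "matches C t s" "t \<notin> fst ` C" "matches C x s" "poly p x < 0"
  shows "\<exists>y. matches C t y \<and> poly q y < 0"
proof (rule neg_transfer[OF C assms(1,2)])
  show "sgn (poly (pderiv p) t) \<noteq> 0" by (rule sgn_pderiv(1)[OF assms(1,2)])
  show "sgn (poly (pderiv p) x) = sgn (poly (pderiv p) t)" if "matches C x s" for x
    by (rule sgn_pderiv(2)[OF assms(1,2) that])
  show "sgn (poly (pderiv q) y) = sgn (poly (pderiv p) t)" if "matches C t y" for y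
    by (rule sgn_pderiv(3)[OF assms(1,2) that])
  show "sgn (poly p a) = sgn (poly q b)" if "(a, b) \<in> C" for a b
    using that by (rule sgn_knots)
qed (rule assms)+


lemma right_root_between:
  assumes "matches C t a" "matches C t b" "poly q a < 0" "poly q b > 0"
  shows "\<exists>y. matches C t y \<and> poly q y = 0"
proof -
  obtain y where y: "min a b \<le> y" "y \<le> max a b" "poly q y = 0"
    using poly_root_between[OF assms(3,4)] by blast
  then have "matches C t y" using matches_between_right[OF assms(1,2)] by blast
  then show ?thesis using y by blast
qed

text \<open>A root inside an open cell is a crossing, since \<open>p\<close> is strictly monotone
  there. So \<open>p\<close> takes both signs in the cell; both are transferred to \<open>q\<close>,
  and the intermediate value theorem yields a root.\<close>

lemma root_right:
  assumes t: "poly p t = 0"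
  shows "\<exists>s. matches C t s \<and> poly q s = 0"
proof (cases "t \<in> fst ` C")
  case True
  then obtain b where "(t, b) \<in> C" by force
  then have "matches C t b" "sgn (poly q b) = 0"
    using order_iso_matches[OF C] sgn_knots t by force+
  then show ?thesis by (auto simp: sgn_zero_iff)
next
  case False
  obtain s where s: "matches C t s" using order_iso_total[OF C] by blast
  obtain l u where lu: "l < t" "t < u" "\<And>x. l < x \<Longrightarrow> x < u \<Longrightarrow> matches C x s"
    using matches_open[OF C s False] by blast
  define a b where "a = (l + t) / 2" and "b = (t + u) / 2"
  have ab: "matches C a s" "matches C b s" "a < t" "t < b"
    unfolding a_def b_def using lu by (auto intro!: lu(3))
  have "sgn (poly p a) = - sgn (poly (pderiv p) t)" "sgn (poly p b) = sgn (poly (pderiv p) t)"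
    using sgn_left_diff[OF s False s ab(1)] sgn_left_diff[OF s False s ab(2)] t ab(3,4) by auto
  then consider "poly p a < 0" "poly p b > 0" | "poly p b < 0" "poly p a > 0"
    using sgn_pderiv(1)[OF s False] by (auto simp: sgn_if split: if_splits)
  then obtain a' b' where "matches C t a'" "matches C t b'" "poly q a' < 0" "poly q b' > 0"
    using neg_right[OF s False] pos_right[OF s False] ab(1,2) by cases blast+
  then show ?thesis by (rule right_root_between)
qed

text \<open>By Rolle's theorem a root of the derivative lies between two roots of \<open>p\<close>.
  It is a knot, and its partner separates \<open>s\<close> from \<open>s'\<close>. In particular a
  cell holds at most one root.\<close>

lemma roots_less:
  assumes "matches C t s" "matches C t' s'" "poly p t = 0" "poly p t' = 0" "t < t'"
  shows "s < s'"
proof -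
  obtain z where z: "t < z" "z < t'" "poly (pderiv p) z = 0"
    using poly_MVT[OF assms(5), of p] assms(3,4,5) by auto
  then obtain b where b: "(z, b) \<in> C"
    using sign_isoD(2)[OF iso pderiv_mem pderiv_nz(1)] by force
  show ?thesis
    using matches_less_iff(1)[OF assms(1) b] matches_less_iff(2)[OF assms(2) b] z by linarith
qed

text \<open>Everything shown so far from left to right becomes available from right to left.\<close>

interpretation conv: sign_iso_step "C\<inverse>" "P\<inverse>" q p
  by (rule converse_step)

lemma root_left: "poly q s = 0 \<Longrightarrow> \<exists>t. matches C t s \<and> poly p t = 0"
  using conv.root_right by (simp add: matches_converse)

lemma not_knot_converse: "matches C t s \<Longrightarrow> t \<notin> fst ` C \<Longrightarrow> s \<notin> fst ` (C\<inverse>)"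
  using matches_knot' by force

text \<open>The sign of \<open>q\<close> at \<open>s\<close> is attained by \<open>p\<close>
  somewhere in the cell of \<open>t\<close>; being opposite to the sign of \<open>p\<close> at
  \<open>t\<close>, it forces a root between.\<close>

lemma root_in_cell:
  assumes ts: "matches C t s" "t \<notin> fst ` C" and neq: "sgn (poly p t) \<noteq> sgn (poly q s)"
    and nz: "poly p t \<noteq> 0" "poly q s \<noteq> 0"
  shows "\<exists>t0. matches C t0 s \<and> poly p t0 = 0"
proof -
  consider "poly p t < 0" "poly q s > 0" | "poly p t > 0" "poly q s < 0"
    using neq nz by (auto simp: sgn_if split: if_splits)
  then show ?thesis
  proof cases
    case 1
    then obtain t1 where "matches C t1 s" "poly p t1 > 0"
      using conv.pos_right[of s t s] not_knot_converse[OF ts] ts by (auto simp: matches_converse)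
    then show ?thesis
      using conv.right_root_between[of s t t1] 1 ts(1) by (simp add: matches_converse)
  next
    case 2
    then obtain t1 where "matches C t1 s" "poly p t1 < 0"
      using conv.neg_right[of s t s] not_knot_converse[OF ts] ts by (auto simp: matches_converse)
    then show ?thesis
      using conv.right_root_between[of s t1 t] 2 ts(1) by (simp add: matches_converse)
  qed
qed

text \<open>At an old knot an added pair already belongs to \<open>C\<close>; in an open cell at
  most one pair is added, by Rolle's theorem.\<close>

definition extended where
  "extended = C \<union> {(t, s). matches C t s \<and> poly p t = 0 \<and> poly q s = 0}"

lemma order_iso_extended: "order_iso extended"
  unfolding order_iso_def
proof (intro conjI allI impI)
  have "p \<noteq> 0" "q \<noteq> 0" using pderiv_nz by auto
  then have "finite ({t. poly p t = 0} \<times> {s. poly q s = 0})"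
    by (simp add: poly_roots_finite)
  then show "finite extended"
    unfolding extended_def using C finite_subset
    by (auto simp: order_iso_def intro: finite_subset[of _ "{t. poly p t = 0} \<times> {s. poly q s = 0}"])
next
  fix a b assume ab: "(a, b) \<in> extended"
  then have mab: "matches C a b" using order_iso_matches[OF C] by (auto simp: extended_def)
  show "matches extended a b"
    unfolding matches_def
  proof (intro allI impI)
    fix c e assume ce: "(c, e) \<in> extended"
    then have mce: "matches C c e" using order_iso_matches[OF C] by (auto simp: extended_def)
    consider "(c, e) \<in> C" | "(a, b) \<in> C" |
      "poly p a = 0" "poly q b = 0" "poly p c = 0" "poly q e = 0"
      using ab ce by (auto simp: extended_def)
    then show "sgn (a - c) = sgn (b - e)"
    proof cases
      case 1
      then show ?thesis using matchesD[OF mab] by simp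
    next
      case 2
      then have "sgn (c - a) = sgn (e - b)" using matchesD[OF mce] by simp
      then show ?thesis by (metis minus_diff_eq sgn_minus)
    next
      case 3
      \<comment> \<open>Equality needs no separate treatment: strict inequalities carried over in
        both directions leave it as the only remaining possibility.\<close>
      have less: "a < c \<Longrightarrow> b < e" "c < a \<Longrightarrow> e < b"
        using roots_less[OF mab mce] roots_less[OF mce mab] 3 by auto
      have less': "b < e \<Longrightarrow> a < c" "e < b \<Longrightarrow> c < a"
        using conv.roots_less[of b a e c] conv.roots_less[of e c b a] mab mce 3
        by (auto simp: matches_converse)
      show ?thesis using less less' by (intro sgn_diff_eqI) force+
    qed
  qed
qed

text \<open>The substantial case is an open cell of \<open>C\<close> where neither value vanishes.
  If the signs differed, the cell would contain a pair of roots, now a knot \<open>(a, b)\<close>;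
  by monotonicity both signs are then the position relative to this knot times the common sign of
  the derivative, hence equal.\<close>

lemma sgn_extended:
  assumes "matches extended t s"
  shows "sgn (poly p t) = sgn (poly q s)"
proof -
  have ts: "matches C t s" using assms by (auto simp: matches_def extended_def)
  consider "t \<in> fst ` C" | "poly p t = 0" | "poly q s = 0"
    | "t \<notin> fst ` C" "poly p t \<noteq> 0" "poly q s \<noteq> 0" by blast
  then show ?thesis
  proof cases
    case 1
    then show ?thesis using matches_knot[OF ts] sgn_knots by blast
  next
    case 2
    then obtain s' where s': "matches C t s'" "poly q s' = 0" using root_right by blast
    then have "(t, s') \<in> extended" using 2 by (simp add: extended_def)
    then have "s = s'" using matches_less_iff(3)[OF assms] by blast
    then show ?thesis using s' 2 by simp
  next
    case 3
    then obtain t' where t': "matches C t' s" "poly p t' = 0" using root_left by blast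
    then have "(t', s) \<in> extended" using 3 by (simp add: extended_def)
    then have "t = t'" using matches_less_iff(3)[OF assms] by blast
    then show ?thesis using t' 3 by simp
  next
    case 4
    show ?thesis
    proof (rule ccontr)
      assume neq: "\<not> ?thesis"
      then obtain a where a: "matches C a s" "poly p a = 0"
        using root_in_cell[OF ts 4(1)] 4 by blast
      then obtain b where b: "matches C a b" "poly q b = 0" using root_right by blast
      then have "(a, b) \<in> extended" using a by (simp add: extended_def)
      then have "sgn (t - a) = sgn (s - b)" using matchesD[OF assms] by blast
      moreover have "sgn (poly p t) = sgn (t - a) * sgn (poly (pderiv p) t)"
        using sgn_left_diff[OF ts 4(1) a(1) ts] a(2) by simp
      moreover have "sgn (poly q s) = sgn (s - b) * sgn (poly (pderiv p) t)"
        using sgn_right_diff[OF ts 4(1) matches_trans[OF ts a(1) b(1)] ts] b(2) by simp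
      ultimately show False using neq by simp
    qed
  qed
qed

lemma sign_iso_extended: "sign_iso extended (insert (p, q) P)"
proof -
  have sub: "matches C t s" if "matches extended t s" for t s
    using that by (auto simp: matches_def extended_def)
  have p: "t \<in> fst ` extended" if "poly p t = 0" for t
    using root_right[OF that] that by (force simp: extended_def)
  have q: "s \<in> snd ` extended" if "poly q s = 0" for s
    using root_left[OF that] that by (force simp: extended_def)
  show ?thesis
    unfolding sign_iso_def
  proof (intro conjI allI impI)
    fix u v assume uv: "(u, v) \<in> insert (p, q) P"
    show "t \<in> fst ` extended" if "u \<noteq> 0" "poly u t = 0" for t
      using uv p sign_isoD(2)[OF iso _ that] that by (auto simp: extended_def image_Un)
    show "s \<in> snd ` extended" if "v \<noteq> 0" "poly v s = 0" for s
      using uv q sign_isoD(3)[OF iso _ that] that by (auto simp: extended_def image_Un)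
    show "sgn (poly u t) = sgn (poly v s)" if "matches extended t s" for t s
      using uv sgn_extended[OF that] sign_isoD(4)[OF iso _ sub[OF that]] by blast
  qed (rule order_iso_extended)
qed

end

section \<open>Polynomials with parameters\<close>

lemma sgn_power: "sgn (x ^ k) = sgn x ^ k" for x :: real
  by (induction k) (simp_all add: sgn_mult)

text \<open>Elimination uses of the coefficients only that they contain the constants and are closed
  under sums and products. Keeping them as functions of the parameter avoids formal polynomials
  until the very end.\<close>

locale function_ring =
  fixes R :: "('x \<Rightarrow> real) set"
  assumes const: "(\<lambda>_. c) \<in> R"
    and add: "f \<in> R \<Longrightarrow> g \<in> R \<Longrightarrow> (\<lambda>x. f x + g x) \<in> R"
    and mult: "f \<in> R \<Longrightarrow> g \<in> R \<Longrightarrow> (\<lambda>x. f x * g x) \<in> R"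
begin

lemma diff: "f \<in> R \<Longrightarrow> g \<in> R \<Longrightarrow> (\<lambda>x. f x - g x) \<in> R"
  using add[OF _ mult[OF const[of "-1"]], of f g] by simp

lemma sum: "finite I \<Longrightarrow> (\<And>i. i \<in> I \<Longrightarrow> f i \<in> R) \<Longrightarrow> (\<lambda>x. \<Sum>i\<in>I. f i x) \<in> R"
  by (induction I rule: finite_induct) (auto intro: const add)

lemma prod: "finite I \<Longrightarrow> (\<And>i. i \<in> I \<Longrightarrow> f i \<in> R) \<Longrightarrow> (\<lambda>x. \<Prod>i\<in>I. f i x) \<in> R"
  by (induction I rule: finite_induct) (auto intro: const mult)

text \<open>The degree bound is uniform in the parameter, while the actual degree may drop at some
  parameters.\<close>

definition upoly :: "nat \<Rightarrow> ('x \<Rightarrow> real poly) \<Rightarrow> bool" where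
  "upoly n p \<longleftrightarrow> (\<forall>x. degree (p x) \<le> n) \<and> (\<forall>i. (\<lambda>x. coeff (p x) i) \<in> R)"

lemma upoly_mono: "upoly m p \<Longrightarrow> m \<le> n \<Longrightarrow> upoly n p"
  unfolding upoly_def by (meson le_trans)

lemma upoly_coeff: "upoly n p \<Longrightarrow> (\<lambda>x. coeff (p x) i) \<in> R"
  by (simp add: upoly_def)

lemma upoly_add: "upoly m p \<Longrightarrow> upoly n q \<Longrightarrow> upoly (max m n) (\<lambda>x. p x + q x)"
  unfolding upoly_def by (auto intro!: add degree_add_le intro: max.coboundedI1 max.coboundedI2)

lemma upoly_mult:
  assumes "upoly m p" "upoly n q"
  shows "upoly (m + n) (\<lambda>x. p x * q x)"
  unfolding upoly_def
proof (intro conjI allI)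
  show "degree (p x * q x) \<le> m + n" for x
    using assms degree_mult_le[of "p x" "q x"] unfolding upoly_def
    by (meson add_mono le_trans)
  show "(\<lambda>x. coeff (p x * q x) i) \<in> R" for i
    unfolding coeff_mult
    by (rule sum) (simp_all add: mult[OF upoly_coeff[OF assms(1)] upoly_coeff[OF assms(2)]])
qed

lemma upoly_pCons:
  assumes "f \<in> R" "upoly n p"
  shows "upoly (Suc n) (\<lambda>x. pCons (f x) (p x))"
  unfolding upoly_def
proof (intro conjI allI)
  show "degree (pCons (f x) (p x)) \<le> Suc n" for x
    using assms(2) degree_pCons_le[of "f x" "p x"] unfolding upoly_def by (meson Suc_le_mono le_trans)
  show "(\<lambda>x. coeff (pCons (f x) (p x)) i) \<in> R" for i
    using assms(1) upoly_coeff[OF assms(2)] by (cases i) simp_all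
qed

lemma upoly_0: "upoly 0 (\<lambda>x. 0)"
  by (simp add: upoly_def const)

lemma upoly_pderiv:
  assumes "upoly (Suc n) p"
  shows "upoly n (\<lambda>x. pderiv (p x))"
  unfolding upoly_def
proof (intro conjI allI)
  show "degree (pderiv (p x)) \<le> n" for x
    using assms by (simp add: upoly_def degree_pderiv le_diff_conv)
  show "(\<lambda>x. coeff (pderiv (p x)) i) \<in> R" for i
    unfolding coeff_pderiv by (rule mult[OF const upoly_coeff[OF assms]])
qed

lemma upoly_cutoff:
  assumes "upoly n p"
  shows "upoly m (\<lambda>x. poly_cutoff (Suc m) (p x))"
  unfolding upoly_def
proof (intro conjI allI)
  show "degree (poly_cutoff (Suc m) (p x)) \<le> m" for x
    by (rule degree_le) (simp add: coeff_poly_cutoff)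
  show "(\<lambda>x. coeff (poly_cutoff (Suc m) (p x)) i) \<in> R" for i
    using upoly_coeff[OF assms, of i] const[of 0] by (cases "i < Suc m") (simp_all add: coeff_poly_cutoff)
qed

text \<open>Division with the divisor's formal leading coefficient multiplied through, so
  coefficients stay in \<open>R\<close>. Stating the identity only at roots of \<open>q\<close>
  makes the quotient disappear.\<close>

lemma pseudo_remainder:
  assumes q: "upoly (Suc m) q"
  shows "upoly n p \<Longrightarrow> \<exists>r k. upoly m r \<and> (\<forall>x t. poly (q x) t = 0 \<longrightarrow>
    coeff (q x) (Suc m) ^ k * poly (p x) t = poly (r x) t)"
proof (induction n arbitrary: p)
  case 0
  then show ?case by (intro exI[of _ p] exI[of _ 0]) (auto intro: upoly_mono)
next
  case (Suc n)
  show ?case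
  proof (cases "Suc n \<le> m")
    case True
    then show ?thesis using Suc.prems
      by (intro exI[of _ p] exI[of _ 0]) (auto intro: upoly_mono)
  next
    case False
    \<comment> \<open>The shift by \<open>n - m\<close> lifts the formal degree \<open>Suc m\<close>
      of \<open>q\<close> to \<open>Suc n\<close>, so the top coefficients cancel; at a root of
      \<open>q\<close> the subtracted term vanishes.\<close>
    define p' where "p' = (\<lambda>x. smult (coeff (q x) (Suc m)) (p x)
      - monom (coeff (p x) (Suc n)) (n - m) * q x)"
    have coeff_p': "coeff (p' x) i = coeff (q x) (Suc m) * coeff (p x) i -
      (if i < n - m then 0 else coeff (p x) (Suc n) * coeff (q x) (i - (n - m)))" for x i
      by (simp add: p'_def coeff_monom_mult)
    have "degree (p' x) \<le> n" for x
    proof (rule degree_le, intro allI impI)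
      fix i assume i: "n < i"
      show "coeff (p' x) i = 0"
      proof (cases "i = Suc n")
        case True
        then show ?thesis using False by (simp add: coeff_p')
      next
        case ne: False
        have "degree (p x) \<le> Suc n" "degree (q x) \<le> Suc m"
          using Suc.prems q unfolding upoly_def by blast+
        then have "degree (p x) < i" "degree (q x) < i - (n - m)" using i ne False by linarith+
        then have "coeff (p x) i = 0" "coeff (q x) (i - (n - m)) = 0" by (simp_all add: coeff_eq_0)
        then show ?thesis by (simp add: coeff_p')
      qed
    qed
    moreover have "(\<lambda>x. coeff (p' x) i) \<in> R" for i
      unfolding coeff_p' using upoly_coeff[OF q] upoly_coeff[OF Suc.prems]
      by (cases "i < n - m") (simp_all add: diff mult)
    ultimately have "upoly n p'" by (simp add: upoly_def)
    from Suc.IH[OF this] obtain r k where r: "upoly m r"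
      "\<And>x t. poly (q x) t = 0 \<Longrightarrow> coeff (q x) (Suc m) ^ k * poly (p' x) t = poly (r x) t" by blast
    have "coeff (q x) (Suc m) ^ Suc k * poly (p x) t = poly (r x) t" if "poly (q x) t = 0" for x t
      using r(2)[OF that] that by (simp add: p'_def algebra_simps)
    then show ?thesis using r(1) by blast
  qed
qed

text \<open>Truncation makes \<open>Suc m\<close> the formal degree of the divisor and leaves
  \<open>q x\<close> intact wherever this is its actual degree. Having one remainder per degree
  accounts for vanishing leading coefficients.\<close>

lemma pseudo_remainder_at_degree:
  assumes "upoly n p" "upoly l q"
  shows "\<exists>r k. upoly m r \<and> (\<forall>x t. degree (q x) = Suc m \<longrightarrow> poly (q x) t = 0 \<longrightarrow>
    coeff (q x) (Suc m) ^ k * poly (p x) t = poly (r x) t)"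
proof -
  have cutoff: "poly_cutoff (Suc (Suc m)) (q x) = q x" if "degree (q x) = Suc m" for x
    using that by (intro poly_eqI) (simp add: coeff_poly_cutoff coeff_eq_0)
  obtain r k where r: "upoly m r" and k: "\<And>x t. poly (poly_cutoff (Suc (Suc m)) (q x)) t = 0 \<Longrightarrow>
      coeff (poly_cutoff (Suc (Suc m)) (q x)) (Suc m) ^ k * poly (p x) t = poly (r x) t"
    using pseudo_remainder[OF upoly_cutoff[OF assms(2), of "Suc m"] assms(1)] by blast
  show ?thesis
  proof (intro exI conjI allI impI)
    fix x t assume "degree (q x) = Suc m" "poly (q x) t = 0"
    then show "coeff (q x) (Suc m) ^ k * poly (p x) t = poly (r x) t"
      using k[of x t] by (simp add: cutoff)
  qed (rule r)
qed

text \<open>Quantifier elimination in semantic form: equal signs on one finite \<open>F\<close>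
  force a common diagram, while the correspondence \<open>C\<close> may vary with the pair of
  parameters.\<close>

definition resolvable :: "('x \<Rightarrow> real poly) set \<Rightarrow> bool" where
  "resolvable G \<longleftrightarrow> (\<exists>F. finite F \<and> F \<subseteq> R \<and>
     (\<forall>x y. (\<forall>f\<in>F. sgn (f x) = sgn (f y)) \<longrightarrow> (\<exists>C. sign_iso C ((\<lambda>g. (g x, g y)) ` G))))"

lemma resolvable_constants:
  assumes "finite G" "\<And>g. g \<in> G \<Longrightarrow> upoly 0 g"
  shows "resolvable G"
  unfolding resolvable_def
proof (intro exI conjI allI impI)
  let ?F = "(\<lambda>g x. coeff (g x) 0) ` G"
  show "finite ?F" "?F \<subseteq> R" using assms upoly_coeff by auto
  fix x y assume xy: "\<forall>f\<in>?F. sgn (f x) = sgn (f y)"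
  have const: "g z = [:coeff (g z) 0:]" if "g \<in> G" for g z
    using assms(2)[OF that] degree_eq_zeroE[of "g z"] unfolding upoly_def
    by (metis coeff_pCons_0 le_zero_eq)
  \<comment> \<open>Without knots any two points match, which is harmless since nonzero constants
    have no roots.\<close>
  show "sign_iso {} ((\<lambda>g. (g x, g y)) ` G)"
    unfolding sign_iso_def
  proof (intro conjI allI impI)
    show "order_iso {}" by (simp add: order_iso_def)
    fix u v assume "(u, v) \<in> (\<lambda>g. (g x, g y)) ` G"
    then obtain g where g: "g \<in> G" "u = g x" "v = g y" by blast
    have ev: "poly (g z) t = coeff (g z) 0" for z t
      using arg_cong[OF const[OF g(1), of z], of "\<lambda>p. poly p t"] by simp
    show "t \<in> fst ` {}" if "u \<noteq> 0" "poly u t = 0" for t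
      using that const[OF g(1), of x] unfolding g(2) ev by simp
    show "t \<in> snd ` {}" if "v \<noteq> 0" "poly v t = 0" for t
      using that const[OF g(1), of y] unfolding g(3) ev by simp
    show "sgn (poly u t) = sgn (poly v s)" for t s
      using xy g unfolding g(2,3) ev by auto
  qed
qed


text \<open>
  \<open>H\<close> consists of \<open>p'\<close>, of \<open>p\<close> without its top coefficient (which takes over where that
  coefficient vanishes), and of pseudo-remainders of \<open>p\<close>. These have lower degree, so that the
  number of members of top degree drops by one.
\<close>

lemma resolvable_insert:
  assumes G: "finite G" "\<And>g. g \<in> G \<Longrightarrow> upoly (Suc n) g" and p: "upoly (Suc n) p"
  shows "\<exists>H. finite H \<and> (\<forall>h\<in>H. upoly n h) \<and> (resolvable (H \<union> G) \<longrightarrow> resolvable (insert p G))"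
proof -
  define p' where "p' = (\<lambda>x. pderiv (p x))"
  define c where "c = (\<lambda>x. poly_cutoff (Suc n) (p x))"
  define Q where "Q = insert p' G"
  have p': "upoly n p'" unfolding p'_def by (rule upoly_pderiv[OF p])
  have Q: "finite Q" "\<And>q. q \<in> Q \<Longrightarrow> upoly (Suc n) q"
    using G upoly_mono[OF p'] by (auto simp: Q_def)
  have "\<forall>q m. \<exists>r. q \<in> Q \<longrightarrow> upoly m r \<and> (\<exists>k. \<forall>x t. degree (q x) = Suc m \<longrightarrow>
      poly (q x) t = 0 \<longrightarrow> coeff (q x) (Suc m) ^ k * poly (p x) t = poly (r x) t)"
    using pseudo_remainder_at_degree[OF p Q(2)] by blast
  then obtain rem where rem: "\<And>q m. q \<in> Q \<Longrightarrow> upoly m (rem q m)"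
    "\<And>q m. q \<in> Q \<Longrightarrow> \<exists>k. \<forall>x t. degree (q x) = Suc m \<longrightarrow>
      poly (q x) t = 0 \<longrightarrow> coeff (q x) (Suc m) ^ k * poly (p x) t = poly (rem q m x) t"
    by metis
  \<comment> \<open>With \<open>m\<close> in \<open>{..n}\<close> the divisor degree
    \<open>Suc m\<close> covers all positive degrees up to \<open>Suc n\<close>. The derivative is
    among the divisors because its roots are knots too.\<close>
  define H where "H = {p', c} \<union> (\<lambda>(q, m). rem q m) ` (Q \<times> {..n})"
  have fin: "finite H" using Q by (simp add: H_def)
  have deg: "upoly n h" if "h \<in> H" for h
    using that p' upoly_cutoff[OF p] upoly_mono[OF rem(1)] by (auto simp: H_def c_def)
  have "resolvable (insert p G)" if res: "resolvable (H \<union> G)"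
  proof -
    obtain F where F: "finite F" "F \<subseteq> R"
      "\<And>x y. (\<forall>f\<in>F. sgn (f x) = sgn (f y)) \<Longrightarrow> \<exists>C. sign_iso C ((\<lambda>g. (g x, g y)) ` (H \<union> G))"
      using res unfolding resolvable_def by blast
    \<comment> \<open>The sign of every coefficient is recorded: this fixes the actual degree of
      each member and the sign of its leading coefficient.\<close>
    define F' where "F' = F \<union> (\<lambda>(q, i) x. coeff (q x) i) ` (insert p Q \<times> {..Suc n})"
    have "finite F'" using F(1) Q(1) by (simp add: F'_def)
    moreover have "F' \<subseteq> R" using F(2) upoly_coeff[OF p] upoly_coeff[OF Q(2)] by (auto simp: F'_def)
    moreover have "\<exists>C. sign_iso C ((\<lambda>g. (g x, g y)) ` insert p G)"
      if xy: "\<forall>f\<in>F'. sgn (f x) = sgn (f y)" for x y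
    proof -
      have coeff_sgn: "sgn (coeff (q x) i) = sgn (coeff (q y) i)" if "q \<in> insert p Q" "i \<le> Suc n" for q i
      proof -
        have "(\<lambda>x. coeff (q x) i) \<in> F'" using that by (force simp: F'_def)
        from bspec[OF xy this] show ?thesis by simp
      qed
      have coeff_0: "coeff (q x) i = 0 \<longleftrightarrow> coeff (q y) i = 0" if "q \<in> insert p Q" for q i
      proof (cases "i \<le> Suc n")
        case True
        then show ?thesis using coeff_sgn[OF that] by (metis sgn_zero_iff)
      next
        case False
        have "upoly (Suc n) q" using that p Q(2) by blast
        then have "degree (q x) < i" "degree (q y) < i"
          using False unfolding upoly_def by (meson le_less_trans not_le)+
        then show ?thesis by (simp add: coeff_eq_0)
      qed
      have degree_eq: "degree (q x) = degree (q y)" if "q \<in> insert p Q" for q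
        using coeff_0[OF that] unfolding degree_def by simp
      obtain C where C: "sign_iso C ((\<lambda>g. (g x, g y)) ` (H \<union> G))"
        using F(3) xy unfolding F'_def by blast
      show ?thesis
      proof (cases "degree (p x) = Suc n")
        case False
        have "degree (p x) \<le> Suc n" using p by (simp add: upoly_def)
        then have "degree (p x) < Suc n" "degree (p y) < Suc n"
          using False degree_eq[of p] by auto
        then have "p x = c x" "p y = c y"
          unfolding c_def by (auto intro!: poly_eqI simp: coeff_poly_cutoff coeff_eq_0)
        then have "(\<lambda>g. (g x, g y)) ` insert p G \<subseteq> (\<lambda>g. (g x, g y)) ` (H \<union> G)"
          by (auto simp: H_def)
        then show ?thesis using sign_iso_subset[OF C] by blast
      next
        case True
        let ?P = "(\<lambda>g. (g x, g y)) ` Q"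
        have "?P \<subseteq> (\<lambda>g. (g x, g y)) ` (H \<union> G)" by (auto simp: Q_def H_def)
        then have iso: "sign_iso C ?P" by (rule sign_iso_subset[OF C])
        \<comment> \<open>\<open>C\<close> may have knots at roots of \<open>c\<close> or of
          remainders, where nothing is known about the sign of \<open>p\<close>.\<close>
        define D where "D = {(a, b) \<in> C. \<exists>u v. (u, v) \<in> ?P \<and> u \<noteq> 0 \<and> poly u a = 0}"
        have D: "sign_iso D ?P" unfolding D_def by (rule sign_iso_restrict[OF iso])
        have "sign_iso_step D ?P (p x) (p y)"
        proof
          show "(pderiv (p x), pderiv (p y)) \<in> ?P" by (auto simp: Q_def p'_def)
          show "pderiv (p x) \<noteq> 0" "pderiv (p y) \<noteq> 0"
            using True degree_eq[of p] by (simp_all add: pderiv_eq_0_iff)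
          fix a b assume "(a, b) \<in> D"
          then obtain q where ab: "(a, b) \<in> C" and q: "q \<in> Q" "q x \<noteq> 0" "poly (q x) a = 0"
            by (auto simp: D_def)
          have mab: "matches C a b" using order_iso_matches[OF sign_isoD(1)[OF C] ab] .
          have "sgn (poly (q x) a) = sgn (poly (q y) b)"
            using sign_isoD(4)[OF iso _ mab] q(1) by blast
          then have qb: "poly (q y) b = 0" using q(3) by (simp add: sgn_zero_iff)
          have "degree (q x) \<noteq> 0" using q(2,3) by (metis degree_eq_zeroE mult_zero_right add_0_right poly_pCons poly_0 pCons_0_0)
          then obtain m where m: "degree (q x) = Suc m" by (cases "degree (q x)") auto
          then have m': "degree (q y) = Suc m" using degree_eq[of q] q(1) by simp
          have "degree (q x) \<le> Suc n" using Q(2)[OF q(1)] by (simp add: upoly_def)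
          then have mn: "m \<le> n" using m by simp
          obtain k where k: "\<And>x t. degree (q x) = Suc m \<Longrightarrow> poly (q x) t = 0 \<Longrightarrow>
              coeff (q x) (Suc m) ^ k * poly (p x) t = poly (rem q m x) t"
            using rem(2)[OF q(1)] by blast
          have "rem q m \<in> H" using q(1) mn by (auto simp: H_def)
          then have "sgn (poly (rem q m x) a) = sgn (poly (rem q m y) b)"
            using sign_isoD(4)[OF C _ mab] by blast
          \<comment> \<open>The exponent \<open>k\<close> is the same at both parameters, and the
            leading coefficients have the same nonzero sign, so their powers cancel.\<close>
          then have "sgn (coeff (q x) (Suc m)) ^ k * sgn (poly (p x) a) =
              sgn (coeff (q y) (Suc m)) ^ k * sgn (poly (p y) b)"
            unfolding k[OF m q(3), symmetric] k[OF m' qb, symmetric] by (simp add: sgn_mult sgn_power)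
          moreover have "sgn (coeff (q x) (Suc m)) = sgn (coeff (q y) (Suc m))"
            using coeff_sgn q(1) mn by simp
          moreover have "coeff (q y) (Suc m) \<noteq> 0"
            using m' by (metis leading_coeff_0_iff degree_0 nat.distinct(1))
          ultimately show "sgn (poly (p x) a) = sgn (poly (p y) b)"
            by (simp add: sgn_zero_iff)
        qed (rule D)
        from sign_iso_step.sign_iso_extended[OF this] show ?thesis
          by (intro exI, rule sign_iso_subset) (auto simp: Q_def)
      qed
    qed
    ultimately show ?thesis unfolding resolvable_def by blast
  qed
  then show ?thesis using fin deg by blast
qed

text \<open>Induction on the degree bound, and within it on the finite set of members of bound
  \<open>Suc n\<close>. The family \<open>H\<close> of lower degree stays arbitrary in the inner
  induction, since each step enlarges it.\<close>

theorem resolvable: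
  "finite G \<Longrightarrow> (\<And>g. g \<in> G \<Longrightarrow> upoly n g) \<Longrightarrow> resolvable G"
proof (induction n arbitrary: G)
  case 0
  then show ?case by (rule resolvable_constants)
next
  case (Suc n)
  have "resolvable (H \<union> K)"
    if "finite K" "\<And>g. g \<in> K \<Longrightarrow> upoly (Suc n) g" "finite H" "\<And>h. h \<in> H \<Longrightarrow> upoly n h" for H K
    using that
  proof (induction K arbitrary: H rule: finite_induct)
    case empty
    then show ?case using Suc.IH by simp
  next
    case (insert p K)
    have up: "upoly (Suc n) g" if "g \<in> H \<union> K" for g
      using that insert.prems upoly_mono[of n g "Suc n"] by auto
    have "\<exists>H'. finite H' \<and> (\<forall>h\<in>H'. upoly n h) \<and>
        (resolvable (H' \<union> (H \<union> K)) \<longrightarrow> resolvable (insert p (H \<union> K)))"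
      by (rule resolvable_insert) (use insert up in auto)
    then obtain H' where H': "finite H'" "\<And>h. h \<in> H' \<Longrightarrow> upoly n h"
      "resolvable (H' \<union> (H \<union> K)) \<Longrightarrow> resolvable (insert p (H \<union> K))" by blast
    have "resolvable ((H' \<union> H) \<union> K)"
      by (rule insert.IH) (use insert.prems H' in auto)
    then show ?case using H'(3) by (simp add: Un_assoc)
  qed
  from this[of G "{}"] show ?case using Suc.prems by simp
qed

definition determined :: "('x \<Rightarrow> bool) \<Rightarrow> bool" where
  "determined S \<longleftrightarrow> (\<exists>F. finite F \<and> F \<subseteq> R \<and> (\<forall>x y. (\<forall>f\<in>F. sgn (f x) = sgn (f y)) \<longrightarrow> S x = S y))"

text \<open>A witness \<open>t\<close> at one parameter is carried to any matching \<open>s\<close>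
  at the other, where all members of \<open>G\<close> have the same signs.\<close>

lemma determined_projection:
  assumes G: "finite G" "\<And>g. g \<in> G \<Longrightarrow> \<exists>n. upoly n g"
    and S: "\<And>x y s t. (\<And>g. g \<in> G \<Longrightarrow> sgn (poly (g x) t) = sgn (poly (g y) s)) \<Longrightarrow> S x t = S y s"
  shows "determined (\<lambda>x. \<exists>t. S x t)"
proof -
  obtain d where d: "\<And>g. g \<in> G \<Longrightarrow> upoly (d g) g" using G(2) by metis
  have "upoly (Max (d ` G)) g" if "g \<in> G" for g
    using upoly_mono[OF d[OF that]] G(1) that by simp
  then have "resolvable G" using resolvable[OF G(1)] by blast
  then obtain F where F: "finite F" "F \<subseteq> R"
    "\<And>x y. (\<forall>f\<in>F. sgn (f x) = sgn (f y)) \<Longrightarrow> \<exists>C. sign_iso C ((\<lambda>g. (g x, g y)) ` G)"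
    unfolding resolvable_def by blast
  have "\<exists>s. S y s" if xy: "\<forall>f\<in>F. sgn (f x) = sgn (f y)" and t: "S x t" for x y t
  proof -
    obtain C where C: "sign_iso C ((\<lambda>g. (g x, g y)) ` G)" using F(3)[OF xy] by blast
    obtain s where "matches C t s" using order_iso_total[OF sign_isoD(1)[OF C]] by blast
    then have "sgn (poly (g x) t) = sgn (poly (g y) s)" if "g \<in> G" for g
      using sign_isoD(4)[OF C] that by blast
    then show ?thesis using S t by blast
  qed
  then have "(\<exists>t. S x t) = (\<exists>t. S y t)" if "\<forall>f\<in>F. sgn (f x) = sgn (f y)" for x y
    using that by metis
  then show ?thesis unfolding determined_def using F(1,2) by blast
qed

end

section \<open>Projections of sign-determined sets\<close>

text \<open>All assignments form the domain whatever \<open>V\<close> is, so removing a variable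
  changes the set of functions but not their type.\<close>

inductive_set polyfun :: "'v set \<Rightarrow> (('v \<Rightarrow> real) \<Rightarrow> real) set" for V where
  const: "(\<lambda>_. c) \<in> polyfun V"
| var: "v \<in> V \<Longrightarrow> (\<lambda>a. a v) \<in> polyfun V"
| add: "f \<in> polyfun V \<Longrightarrow> g \<in> polyfun V \<Longrightarrow> (\<lambda>a. f a + g a) \<in> polyfun V"
| mult: "f \<in> polyfun V \<Longrightarrow> g \<in> polyfun V \<Longrightarrow> (\<lambda>a. f a * g a) \<in> polyfun V"

interpretation polyring: function_ring "polyfun V" for V
  by unfold_locales (rule polyfun.intros; assumption?)+

text \<open>The function-level version of reading a polynomial in \<open>V\<close> and
  \<open>v\<close> as a univariate polynomial in \<open>v\<close> over the polynomials in
  \<open>V\<close>.\<close>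

lemma polyfun_as_upoly:
  assumes "f \<in> polyfun (insert v V)"
  shows "\<exists>n p. polyring.upoly V n p \<and> (\<forall>a t. f (a(v := t)) = poly (p a) t)"
  using assms
proof induction
  case (const c)
  show ?case
    by (rule exI, rule exI, rule conjI, rule polyring.upoly_pCons[OF polyfun.const polyring.upoly_0])
      simp
next
  case (var w)
  show ?case
  proof (cases "w = v")
    case True
    show ?thesis
      by (rule exI, rule exI, rule conjI, rule polyring.upoly_pCons[OF polyfun.const[of 0]
          polyring.upoly_pCons[OF polyfun.const[of 1] polyring.upoly_0]]) (simp add: True)
  next
    case False
    then have "w \<in> V" using var by simp
    show ?thesis
      by (rule exI, rule exI, rule conjI,
          rule polyring.upoly_pCons[OF polyfun.var[OF \<open>w \<in> V\<close>] polyring.upoly_0]) (simp add: False)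
  qed
next
  case (add f g)
  then obtain m p n q where "polyring.upoly V m p" "\<And>a t. f (a(v := t)) = poly (p a) t"
    "polyring.upoly V n q" "\<And>a t. g (a(v := t)) = poly (q a) t" by blast
  then show ?case
    by (intro exI[of _ "max m n"] exI[of _ "\<lambda>a. p a + q a"]) (simp add: polyring.upoly_add del: fun_upd_apply)
next
  case (mult f g)
  then obtain m p n q where "polyring.upoly V m p" "\<And>a t. f (a(v := t)) = poly (p a) t"
    "polyring.upoly V n q" "\<And>a t. g (a(v := t)) = poly (q a) t" by blast
  then show ?case
    by (intro exI[of _ "m + n"] exI[of _ "\<lambda>a. p a * q a"]) (simp add: polyring.upoly_mult del: fun_upd_apply)
qed

lemma polyfun_projection:
  assumes "polyring.determined (insert v V) S"
  shows "polyring.determined V (\<lambda>a. \<exists>t. S (a(v := t)))"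
proof -
  obtain F where F: "finite F" "F \<subseteq> polyfun (insert v V)"
    "\<And>a b. (\<forall>f\<in>F. sgn (f a) = sgn (f b)) \<Longrightarrow> S a = S b"
    using assms unfolding polyring.determined_def by blast
  have "\<exists>p. (\<exists>n. polyring.upoly V n p) \<and> (\<forall>a t. f (a(v := t)) = poly (p a) t)" if "f \<in> F" for f
    using polyfun_as_upoly[OF subsetD[OF F(2) that]] by (elim exE conjE) (intro exI conjI)
  then have "\<forall>f\<in>F. \<exists>p. (\<exists>n. polyring.upoly V n p) \<and> (\<forall>a t. f (a(v := t)) = poly (p a) t)"
    by (rule ballI)
  from bchoice[OF this] obtain P where
    "\<forall>f\<in>F. (\<exists>n. polyring.upoly V n (P f)) \<and> (\<forall>a t. f (a(v := t)) = poly (P f a) t)" ..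
  then have P: "\<And>f. f \<in> F \<Longrightarrow> \<exists>n. polyring.upoly V n (P f)"
    "\<And>f a t. f \<in> F \<Longrightarrow> f (a(v := t)) = poly (P f a) t" by simp_all
  show ?thesis
  proof (rule polyring.determined_projection[where G = "P ` F"])
    show "S (a(v := t)) = S (b(v := s))"
      if "\<And>g. g \<in> P ` F \<Longrightarrow> sgn (poly (g a) t) = sgn (poly (g b) s)" for a b s t
    proof (rule F(3), rule ballI)
      fix f assume "f \<in> F"
      then show "sgn (f (a(v := t))) = sgn (f (b(v := s)))"
        unfolding P(2)[OF \<open>f \<in> F\<close>] by (intro that imageI)
    qed
  qed (use F(1) P(1) in auto)
qed

text \<open>Tarski--Seidenberg for a block of variables, removed one by one. The block of witnesses
  is coded as one total assignment \<open>b\<close>, of which only the values on \<open>W\<close>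
  are read.\<close>

theorem polyfun_projection_finite:
  assumes "finite W" "polyring.determined (W \<union> V) S"
  shows "polyring.determined V (\<lambda>a. \<exists>b. S (\<lambda>v. if v \<in> W then b v else a v))"
  using assms
proof (induction W arbitrary: S rule: finite_induct)
  case empty
  then show ?case by simp
next
  case (insert w W)
  have "polyring.determined (W \<union> V) (\<lambda>a. \<exists>t. S (a(w := t)))"
    using insert.prems by (intro polyfun_projection) simp
  from insert.IH[OF this] have
    det: "polyring.determined V (\<lambda>a. \<exists>b t. S ((\<lambda>v. if v \<in> W then b v else a v)(w := t)))" .
  have upd: "(\<lambda>v. if v \<in> W then b v else a v)(w := t) =
      (\<lambda>v. if v \<in> insert w W then (b(w := t)) v else a v)" for a b t
    using insert.hyps(2) by auto
  have "(\<exists>b t. S ((\<lambda>v. if v \<in> W then b v else a v)(w := t))) \<longleftrightarrow>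
      (\<exists>b. S (\<lambda>v. if v \<in> insert w W then b v else a v))" for a
    unfolding upd by (metis fun_upd_triv)
  then show ?case using det by simp
qed

section \<open>Polynomial functions as evaluations of formal polynomials\<close>

lemma mpoly_eval_superset:
  assumes "finite M" "Poly_Mapping.keys p \<subseteq> M"
  shows "mpoly_eval p a =
    (\<Sum>m\<in>M. Poly_Mapping.lookup p m * (\<Prod>v\<in>Poly_Mapping.keys m. a v ^ Poly_Mapping.lookup m v))"
  unfolding mpoly_eval_def
  by (rule sum.mono_neutral_left) (use assms in \<open>auto simp: in_keys_iff\<close>)

lemma mpoly_eval_add: "mpoly_eval (p + q) a = mpoly_eval p a + mpoly_eval q a"
proof -
  let ?M = "Poly_Mapping.keys p \<union> Poly_Mapping.keys q"
  show ?thesis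
    using Poly_Mapping.keys_add[of p q]
    by (simp add: mpoly_eval_superset[of ?M] lookup_add distrib_right sum.distrib)
qed

lemma mpoly_eval_sum: "mpoly_eval (\<Sum>i\<in>I. p i) a = (\<Sum>i\<in>I. mpoly_eval (p i) a)"
  by (induction I rule: infinite_finite_induct) (simp_all add: mpoly_eval_add, simp_all add: mpoly_eval_def)

lemma mpoly_eval_single:
  "mpoly_eval (Poly_Mapping.single m c) a =
    c * (\<Prod>v\<in>Poly_Mapping.keys m. a v ^ Poly_Mapping.lookup m v)"
  by (simp add: mpoly_eval_superset[of "{m}"])

lemma monomial_eval_add:
  fixes a :: "'v \<Rightarrow> 'a::comm_semiring_1"
  shows "(\<Prod>v\<in>Poly_Mapping.keys (m + n). a v ^ Poly_Mapping.lookup (m + n) v) =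
    (\<Prod>v\<in>Poly_Mapping.keys m. a v ^ Poly_Mapping.lookup m v) *
    (\<Prod>v\<in>Poly_Mapping.keys n. a v ^ Poly_Mapping.lookup n v)"
proof -
  let ?U = "Poly_Mapping.keys m \<union> Poly_Mapping.keys n"
  have extend: "(\<Prod>v\<in>Poly_Mapping.keys l. a v ^ Poly_Mapping.lookup l v) =
      (\<Prod>v\<in>?U. a v ^ Poly_Mapping.lookup l v)" if "Poly_Mapping.keys l \<subseteq> ?U" for l
    by (rule prod.mono_neutral_left) (use that in \<open>auto simp: in_keys_iff\<close>)
  show ?thesis
    unfolding extend[OF Poly_Mapping.keys_add[of m n]] extend[OF Un_upper1] extend[OF Un_upper2]
    by (simp add: lookup_add power_add prod.distrib)
qed

lemma poly_mapping_sum_singles: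
  fixes p :: "'b \<Rightarrow>\<^sub>0 'a::comm_monoid_add"
  shows "p = (\<Sum>m\<in>Poly_Mapping.keys p. Poly_Mapping.single m (Poly_Mapping.lookup p m))"
proof (rule poly_mapping_eqI)
  fix k
  show "Poly_Mapping.lookup p k =
      Poly_Mapping.lookup (\<Sum>m\<in>Poly_Mapping.keys p. Poly_Mapping.single m (Poly_Mapping.lookup p m)) k"
    by (simp add: lookup_sum lookup_single when_def sum.delta in_keys_iff)
qed

lemma mpoly_eval_mult:
  fixes p q :: "('v, 'a::comm_semiring_1) mpoly"
  shows "mpoly_eval (p * q) a = mpoly_eval p a * mpoly_eval q a"
proof -
  have "p * q = (\<Sum>m\<in>Poly_Mapping.keys p. \<Sum>n\<in>Poly_Mapping.keys q.
      Poly_Mapping.single (m + n) (Poly_Mapping.lookup p m * Poly_Mapping.lookup q n))"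
    by (subst poly_mapping_sum_singles[of p], subst poly_mapping_sum_singles[of q])
      (simp add: sum_product mult_single)
  then have "mpoly_eval (p * q) a = (\<Sum>m\<in>Poly_Mapping.keys p. \<Sum>n\<in>Poly_Mapping.keys q.
      (Poly_Mapping.lookup p m * (\<Prod>v\<in>Poly_Mapping.keys m. a v ^ Poly_Mapping.lookup m v)) *
      (Poly_Mapping.lookup q n * (\<Prod>v\<in>Poly_Mapping.keys n. a v ^ Poly_Mapping.lookup n v)))"
    by (simp add: mpoly_eval_sum mpoly_eval_single monomial_eval_add mult_ac)
  also have "\<dots> = mpoly_eval p a * mpoly_eval q a"
    unfolding mpoly_eval_def by (rule sum_product[symmetric])
  finally show ?thesis .
qed

lemma mpoly_vars_add: "mpoly_vars (p + q) \<subseteq> mpoly_vars p \<union> mpoly_vars q"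
  using Poly_Mapping.keys_add[of p q] unfolding mpoly_vars_def by blast

lemma mpoly_vars_mult: "mpoly_vars (p * q) \<subseteq> mpoly_vars p \<union> mpoly_vars q"
  unfolding mpoly_vars_def
proof
  fix v assume "v \<in> \<Union> (Poly_Mapping.keys ` Poly_Mapping.keys (p * q))"
  then obtain m where m: "m \<in> Poly_Mapping.keys (p * q)" "v \<in> Poly_Mapping.keys m" by blast
  then obtain m1 m2 where "m = m1 + m2" "m1 \<in> Poly_Mapping.keys p" "m2 \<in> Poly_Mapping.keys q"
    using Poly_Mapping.keys_mult[of p q] by blast
  then show "v \<in> \<Union> (Poly_Mapping.keys ` Poly_Mapping.keys p) \<union> \<Union> (Poly_Mapping.keys ` Poly_Mapping.keys q)"
    using m(2) Poly_Mapping.keys_add[of m1 m2] by blast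
qed

lemma polyfun_mpoly:
  assumes "f \<in> polyfun V"
  shows "\<exists>p :: ('v, real) mpoly. mpoly_vars p \<subseteq> V \<and> (\<forall>a. mpoly_eval p a = f a)"
  using assms
proof induction
  case (const c)
  show ?case
    by (rule exI[of _ "Poly_Mapping.single 0 c"]) (simp add: mpoly_eval_single mpoly_vars_def)
next
  case (var v)
  then show ?case
    by (intro exI[of _ "Poly_Mapping.single (Poly_Mapping.single v 1) 1"])
      (simp add: mpoly_eval_single mpoly_vars_def)
next
  case (add f g)
  then obtain p q :: "('v, real) mpoly" where "mpoly_vars p \<subseteq> V" "mpoly_vars q \<subseteq> V"
    "\<And>a. mpoly_eval p a = f a" "\<And>a. mpoly_eval q a = g a" by blast
  then show ?case using mpoly_vars_add[of p q]
    by (intro exI[of _ "p + q"]) (auto simp: mpoly_eval_add)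
next
  case (mult f g)
  then obtain p q :: "('v, real) mpoly" where "mpoly_vars p \<subseteq> V" "mpoly_vars q \<subseteq> V"
    "\<And>a. mpoly_eval p a = f a" "\<And>a. mpoly_eval q a = g a" by blast
  then show ?case using mpoly_vars_mult[of p q]
    by (intro exI[of _ "p * q"]) (auto simp: mpoly_eval_mult)
qed

section \<open>Application to tensor rank\<close>

lemma polyfun_Inl:
  "f \<in> polyfun (Inl ` V) \<Longrightarrow> (\<lambda>a. f (case_sum a (\<lambda>_. 0))) \<in> polyfun V"
  by (induction rule: polyfun.induct) (auto intro: polyfun.intros)

text \<open>Both sides vanish outside \<open>tensor_index k d\<close>, which leaves finitely many
  polynomial equations in the entries and the coordinates of the factors.\<close>

lemma sum_of_decomposables_iff:
  assumes A: "A \<in> tensors k d"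
  shows "sum_of_decomposables k d A r \<longleftrightarrow>
    (\<exists>x. \<forall>j\<in>tensor_index k d. A j = (\<Sum>s<r. \<Prod>i=1..k. x s i (j i)))"
proof
  assume "sum_of_decomposables k d A r"
  then obtain T where T: "\<And>s. s < r \<Longrightarrow> decomposable k d (T s)" "A = (\<lambda>j. \<Sum>s<r. T s j)"
    unfolding sum_of_decomposables_def by blast
  then obtain x where x: "\<And>s. s < r \<Longrightarrow> T s = outer_product k d (x s)"
    unfolding decomposable_def by metis
  show "\<exists>x. \<forall>j\<in>tensor_index k d. A j = (\<Sum>s<r. \<Prod>i=1..k. x s i (j i))"
    by (rule exI[of _ x]) (simp add: T(2) x outer_product_def)
next
  assume "\<exists>x. \<forall>j\<in>tensor_index k d. A j = (\<Sum>s<r. \<Prod>i=1..k. x s i (j i))"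
  then obtain x where x: "\<And>j. j \<in> tensor_index k d \<Longrightarrow> A j = (\<Sum>s<r. \<Prod>i=1..k. x s i (j i))"
    by blast
  have "A j = (\<Sum>s<r. outer_product k d (x s) j)" for j
    using A x[of j] by (cases "j \<in> tensor_index k d") (simp_all add: outer_product_def tensors_def)
  then have "A = (\<lambda>j. \<Sum>s<r. outer_product k d (x s) j)" by (rule ext)
  then show "sum_of_decomposables k d A r"
    unfolding sum_of_decomposables_def decomposable_def
    by (intro exI[of _ "\<lambda>s. outer_product k d (x s)"]) auto
qed

text \<open>One decomposable summand per entry. This gives a bound on the rank that is uniform over
  all arrays of the format.\<close>

lemma sum_of_decomposables_card:
  assumes "k \<ge> 1" and A: "A \<in> tensors k d"
  shows "sum_of_decomposables k d A (card (tensor_index k d))"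
proof -
  obtain l where l: "bij_betw l {..<card (tensor_index k d)} (tensor_index k d)"
    using ex_bij_betw_nat_finite[OF finite_tensor_index, of k d] by (auto simp: atLeast0LessThan)
  define T where "T = (\<lambda>s j. if j = l s then A (l s) else 0)"
  have "decomposable k d (T s)" if "s < card (tensor_index k d)" for s
    unfolding T_def using that l \<open>k \<ge> 1\<close> by (intro decomposable_unit) (auto simp: bij_betw_def)
  moreover have "A j = (\<Sum>s<card (tensor_index k d). T s j)" for j
  proof -
    have "(\<Sum>s<card (tensor_index k d). T s j) = (\<Sum>i\<in>tensor_index k d. if j = i then A i else 0)"
      unfolding T_def by (rule sum.reindex_bij_betw[OF l])
    then show ?thesis
      using A finite_tensor_index by (auto simp: tensors_def sum.delta')
  qed
  ultimately show ?thesis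
    unfolding sum_of_decomposables_def by (intro exI[of _ T] conjI ext) simp_all
qed

text \<open>The arrays in question are the projection of the common zero set of the polynomials
  \<open>e j\<close> to the entries; the coordinates of the factors are eliminated.\<close>

lemma sum_of_decomposables_sign_determined:
  "\<exists>F. finite F \<and> F \<subseteq> polyfun (tensor_index k d) \<and>
    (\<forall>A\<in>tensors k d. \<forall>A'\<in>tensors k d. (\<forall>f\<in>F. sgn (f A) = sgn (f A')) \<longrightarrow>
      sum_of_decomposables k d A r = sum_of_decomposables k d A' r)"
proof -
  let ?I = "tensor_index k d"
  define V :: "((nat \<Rightarrow> nat) + nat \<times> nat \<times> nat) set" where "V = Inl ` ?I"
  \<comment> \<open>\<open>Inr (s, i, n)\<close> is coordinate \<open>n\<close> of factor
    \<open>i\<close> in summand \<open>s\<close>. One common range for \<open>n\<close> turns the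
    index set into a finite box.\<close>
  define W :: "((nat \<Rightarrow> nat) + nat \<times> nat \<times> nat) set"
    where "W = Inr ` ({..<r} \<times> {1..k} \<times> (\<Union>i\<in>{1..k}. {1..d i}))"
  define e :: "(nat \<Rightarrow> nat) \<Rightarrow> ((nat \<Rightarrow> nat) + nat \<times> nat \<times> nat \<Rightarrow> real) \<Rightarrow> real"
    where "e = (\<lambda>j a. a (Inl j) - (\<Sum>s<r. \<Prod>i=1..k. a (Inr (s, i, j i))))"
  define S where "S = (\<lambda>a. \<forall>j\<in>?I. e j a = 0)"
  have W: "Inr (s, i, j i) \<in> W" if "s < r" "i \<in> {1..k}" "j \<in> ?I" for s i j
    using that PiE_mem[of j "{1..k}" "\<lambda>i. {1..d i}" i] by (force simp: W_def tensor_index_def)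
  have "finite W" by (simp add: W_def)
  moreover have "polyring.determined (W \<union> V) S"
    unfolding polyring.determined_def
  proof (intro exI conjI allI impI)
    show "finite (e ` ?I)" by (simp add: finite_tensor_index)
    show "e ` ?I \<subseteq> polyfun (W \<union> V)"
      unfolding e_def
      by (auto intro!: polyring.diff polyring.sum polyring.prod polyfun.var W simp: V_def)
    show "S a = S b" if "\<forall>f\<in>e ` ?I. sgn (f a) = sgn (f b)" for a b
      using that unfolding S_def by (metis imageI sgn_zero_iff)
  qed
  ultimately have "polyring.determined V (\<lambda>a. \<exists>b. S (\<lambda>v. if v \<in> W then b v else a v))"
    by (rule polyfun_projection_finite)
  then obtain F where F: "finite F" "F \<subseteq> polyfun V" and
    FS: "\<And>a a'. (\<forall>f\<in>F. sgn (f a) = sgn (f a')) \<Longrightarrow>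
      (\<exists>b. S (\<lambda>v. if v \<in> W then b v else a v)) = (\<exists>b. S (\<lambda>v. if v \<in> W then b v else a' v))"
    unfolding polyring.determined_def by blast
  have S: "sum_of_decomposables k d A r \<longleftrightarrow>
      (\<exists>b. S (\<lambda>v. if v \<in> W then b v else case_sum A (\<lambda>_. 0) v))" if "A \<in> tensors k d" for A
  proof -
    have eval: "e j (\<lambda>v. if v \<in> W then b v else case_sum A (\<lambda>_. 0) v) =
        A j - (\<Sum>s<r. \<Prod>i=1..k. b (Inr (s, i, j i)))" if "j \<in> ?I" for b j
      using W that by (simp add: e_def) (simp add: W_def image_iff)
    have "(\<exists>x. \<forall>j\<in>?I. A j = (\<Sum>s<r. \<Prod>i=1..k. x s i (j i))) \<longleftrightarrow>
        (\<exists>b. \<forall>j\<in>?I. A j = (\<Sum>s<r. \<Prod>i=1..k. b (Inr (s, i, j i) :: (nat \<Rightarrow> nat) + nat \<times> nat \<times> nat)))"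
    proof
      assume "\<exists>x. \<forall>j\<in>?I. A j = (\<Sum>s<r. \<Prod>i=1..k. x s i (j i))"
      then obtain x where "\<forall>j\<in>?I. A j = (\<Sum>s<r. \<Prod>i=1..k. x s i (j i))" by blast
      then show "\<exists>b. \<forall>j\<in>?I. A j = (\<Sum>s<r. \<Prod>i=1..k. b (Inr (s, i, j i) :: (nat \<Rightarrow> nat) + nat \<times> nat \<times> nat))"
        by (intro exI[of _ "case_sum (\<lambda>_. 0) (\<lambda>(s, i, n). x s i n)"]) simp
    next
      assume "\<exists>b. \<forall>j\<in>?I. A j = (\<Sum>s<r. \<Prod>i=1..k. b (Inr (s, i, j i) :: (nat \<Rightarrow> nat) + nat \<times> nat \<times> nat))"
      then obtain b :: "(nat \<Rightarrow> nat) + nat \<times> nat \<times> nat \<Rightarrow> real"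
        where "\<forall>j\<in>?I. A j = (\<Sum>s<r. \<Prod>i=1..k. b (Inr (s, i, j i)))" by blast
      then show "\<exists>x. \<forall>j\<in>?I. A j = (\<Sum>s<r. \<Prod>i=1..k. x s i (j i))"
        by (intro exI[of _ "\<lambda>s i n. b (Inr (s, i, n))"]) simp
    qed
    then show ?thesis
      unfolding sum_of_decomposables_iff[OF that] S_def by (simp add: eval)
  qed
  \<comment> \<open>Functions in \<open>F\<close> read only variables tagged by \<open>Inl\<close>,
    so padding with 0 turns them into functions of the array alone.\<close>
  let ?F = "(\<lambda>f a. f (case_sum a (\<lambda>_. 0))) ` F"
  have "finite ?F" "?F \<subseteq> polyfun ?I"
    using F polyfun_Inl unfolding V_def by auto
  moreover have "sum_of_decomposables k d A r = sum_of_decomposables k d A' r"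
    if "A \<in> tensors k d" "A' \<in> tensors k d" "\<forall>f\<in>?F. sgn (f A) = sgn (f A')" for A A'
    unfolding S[OF that(1)] S[OF that(2)] by (rule FS) (use that(3) in simp)
  ultimately show ?thesis by (intro exI[of _ ?F] conjI ballI impI)
qed

theorem corollary6p3:
  fixes k :: nat and d :: "nat \<Rightarrow> nat"
  assumes "k \<ge> 1" and "\<forall>i\<in>{1..k}. d i \<ge> 1"
  shows "\<exists>(m :: nat) (\<Delta> :: nat \<Rightarrow> (nat \<Rightarrow> nat, real) mpoly).
           (\<forall>i\<le>m. mpoly_vars (\<Delta> i) \<subseteq> tensor_index k d) \<and>
           (\<forall>A\<in>tensors k d. \<forall>A'\<in>tensors k d.
              (\<forall>i\<le>m. sgn (mpoly_eval (\<Delta> i) A) = sgn (mpoly_eval (\<Delta> i) A')) \<longrightarrow>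
              outer_rank k d A = outer_rank k d A')"
proof -
  define N where "N = card (tensor_index k d)"
  obtain F where F: "\<And>r. finite (F r)" "\<And>r. F r \<subseteq> polyfun (tensor_index k d)"
    "\<And>r A A'. A \<in> tensors k d \<Longrightarrow> A' \<in> tensors k d \<Longrightarrow> (\<forall>f\<in>F r. sgn (f A) = sgn (f A')) \<Longrightarrow>
      sum_of_decomposables k d A r = sum_of_decomposables k d A' r"
    using sum_of_decomposables_sign_determined[of k d] by metis
  obtain fs where fs: "set fs = (\<Union>r\<le>N. F r)"
    using finite_list[of "\<Union>r\<le>N. F r"] F(1) by blast
  have "\<forall>f. \<exists>p. f \<in> polyfun (tensor_index k d) \<longrightarrow>
      mpoly_vars p \<subseteq> tensor_index k d \<and> (\<forall>a. mpoly_eval p a = f a)"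
    using polyfun_mpoly by blast
  then obtain P where P: "\<And>f. f \<in> polyfun (tensor_index k d) \<Longrightarrow> mpoly_vars (P f) \<subseteq> tensor_index k d"
    "\<And>f a. f \<in> polyfun (tensor_index k d) \<Longrightarrow> mpoly_eval (P f) a = f a" by metis
  \<comment> \<open>With \<open>m = length fs\<close> the last polynomial is 0, of constant sign; so
    an index \<open>m\<close> exists even when \<open>fs\<close> is empty.\<close>
  define \<Delta> where "\<Delta> = (\<lambda>i. if i < length fs then P (fs ! i) else 0)"
  have poly: "f \<in> polyfun (tensor_index k d)" if "f \<in> set fs" for f
    using that F(2) by (auto simp: fs)
  have "mpoly_vars (\<Delta> i) \<subseteq> tensor_index k d" for i
    using P(1)[OF poly] by (simp add: \<Delta>_def mpoly_vars_def)
  moreover have "outer_rank k d A = outer_rank k d A'"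
    if A: "A \<in> tensors k d" "A' \<in> tensors k d"
      and sgn_eq: "\<forall>i\<le>length fs. sgn (mpoly_eval (\<Delta> i) A) = sgn (mpoly_eval (\<Delta> i) A')" for A A'
  proof -
    have sgn_fs: "sgn (f A) = sgn (f A')" if f: "f \<in> set fs" for f
    proof -
      obtain i where "i < length fs" "f = fs ! i" using f by (metis in_set_conv_nth)
      then show ?thesis using sgn_eq[rule_format, of i] P(2)[OF poly[OF f]] by (simp add: \<Delta>_def)
    qed
    have eq: "sum_of_decomposables k d A r = sum_of_decomposables k d A' r" if "r \<le> N" for r
      by (rule F(3)[OF A]) (use that sgn_fs in \<open>auto simp: fs\<close>)
    have le: "outer_rank k d B \<le> N" if "B \<in> tensors k d" for B
      unfolding outer_rank_def N_def using sum_of_decomposables_card[OF assms(1) that] by (rule Least_le)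
    have rank: "sum_of_decomposables k d B (outer_rank k d B)" if "B \<in> tensors k d" for B
      using sum_of_decomposables_outer_rank[OF assms(1) that] .
    \<comment> \<open>The minimum for \<open>A'\<close> is at most \<open>N\<close>, hence in the
      range where attainability transfers to \<open>A\<close>; the converse is symmetric.\<close>
    have "outer_rank k d A \<le> outer_rank k d A'"
      using eq[OF le[OF A(2)]] rank[OF A(2)] unfolding outer_rank_def[of k d A] by (metis Least_le)
    moreover have "outer_rank k d A' \<le> outer_rank k d A"
      using eq[OF le[OF A(1)]] rank[OF A(1)] unfolding outer_rank_def[of k d A'] by (metis Least_le)
    ultimately show ?thesis by simp
  qed
  ultimately show ?thesis by blast
qed

end
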